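(* Let $f$ be an inner function with $f(0)=0$ which is not a rotation. If $\{a_{n}\}_{n\ge1}$ is a sequence of complex numbers with $\sum^{\infty}_{n=1}|a_{n}|^{2}<\infty$, then $\sum^{\infty}_{n=1}a_{n} f^{n}\in \mathbb{H}^{p}(\mathbb{D})$ for any $0<p<\infty$. Moreover for any $0<p<\infty$, there exists a constant $C(p,f)>0$ such that for any sequence of complex numbers $\{a_{n}\}$ with $\sum_{n=1}^\infty|a_n|^2<\infty$ we have $$ C(p,f)^{-1}\left(\sum^{\infty}_{n=1}|a_{n}|^{2}\right)^{1/2} \le\left\|\sum_{n=1}^{\infty}a_{n}f^{n}\right\|_{p}\le C(p,f)\left(\sum^{\infty}_{n=1}|a_{n}|^{2}\right)^{1/2}. $$
   Context: $\mathbb{D}$ is the open unit disc and $\partial\mathbb{D}$ the unit circle; $m$ is normalized Lebesgue measure on $\partial\mathbb{D}$. An inner function is an analytic mapping $f:\mathbb{D}\to\mathbb{D}$ whose radial limits have modulus one at almost every point of $\partial\mathbb{D}$. A rotation is a map $z\mapsto \lambda z$ with $|\lambda|=1$. $f^{n}$ denotes the $n$-th iterate of $f$ (not the power). When $\sum|a_n|^2<\infty$, the series $\sum a_nf^n$ converges in $\mathbb{H}^2(\mathbb{D})$ (hence uniformly on compact subsets of $\mathbb{D}$), and $\sum a_nf^n$ denotes its sum. For $0<p<\infty$, $\mathbb{H}^{p}(\mathbb{D})$ is the Hardy space of analytic functions $F$ in $\mathbb{D}$ with $\|F\|_{p}^{p}=\sup_{r<1}\int_{\partial\mathbb{D}}|F(r\xi)|^{p}\,dm(\xi)<\infty$.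 *)

theory Defs
  imports "HOL-Complex_Analysis.Complex_Analysis"
begin

definition circle_measure :: "complex measure" where
  "circle_measure =
     distr (uniform_measure lborel {0..<2 * pi}) (restrict_space borel (sphere 0 1)) cis"

text \<open>Functions on the disc are total functions on \<^typ>\<open>complex\<close>; all notions below
  depend only on their values on \<^term>\<open>ball (0::complex) 1\<close>.\<close>

definition inner_function :: "(complex \<Rightarrow> complex) \<Rightarrow> bool" where
  "inner_function f \<longleftrightarrow>
     f holomorphic_on ball 0 1 \<and> f ` ball 0 1 \<subseteq> ball 0 1 \<and>
     (AE \<xi> in circle_measure.
        \<exists>l. ((\<lambda>r. f (complex_of_real r * \<xi>)) \<longlongrightarrow> l) (at_left 1) \<and> norm l = 1)"

definition is_rotation :: "(complex \<Rightarrow> complex) \<Rightarrow> bool" where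
  "is_rotation f \<longleftrightarrow> (\<exists>c. norm c = 1 \<and> (\<forall>z\<in>ball 0 1. f z = c * z))"

text \<open>The supremum of the integral means, i.e. the \<open>p\<close>-th power of the Hardy norm,
  with value \<open>\<infinity>\<close> allowed.\<close>

definition hardy_mean_sup :: "real \<Rightarrow> (complex \<Rightarrow> complex) \<Rightarrow> ennreal" where
  "hardy_mean_sup p F =
     (SUP r\<in>{0..<1::real}. \<integral>\<^sup>+\<xi>. ennreal (norm (F (complex_of_real r * \<xi>)) powr p) \<partial>circle_measure)"

definition hardy_space :: "real \<Rightarrow> (complex \<Rightarrow> complex) set" where
  "hardy_space p = {F. F holomorphic_on ball 0 1 \<and> hardy_mean_sup p F < \<infinity>}"

text \<open>Meaningful only on \<^term>\<open>hardy_space p\<close>: \<^const>\<open>enn2real\<close> sends \<open>\<infinity>\<close> to \<open>0\<close>.\<close>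

definition hardy_norm :: "real \<Rightarrow> (complex \<Rightarrow> complex) \<Rightarrow> real" where
  "hardy_norm p F = enn2real (hardy_mean_sup p F) powr (1 / p)"

definition hardy_sums ::
    "real \<Rightarrow> (nat \<Rightarrow> complex \<Rightarrow> complex) \<Rightarrow> (complex \<Rightarrow> complex) \<Rightarrow> bool" where
  "hardy_sums p g F \<longleftrightarrow>
     (\<forall>n. g n \<in> hardy_space p) \<and> F \<in> hardy_space p \<and>
     (\<lambda>N. hardy_norm p (\<lambda>z. F z - (\<Sum>n<N. g n z))) \<longlonglongrightarrow> 0"

text \<open>Sequences are indexed from 1, so the value \<open>a 0\<close> plays no role; \<open>f ^^ n\<close> is the
  \<open>n\<close>-th iterate of \<open>f\<close>.\<close>

definition iterate_series :: "(nat \<Rightarrow> complex) \<Rightarrow> (complex \<Rightarrow> complex) \<Rightarrow> complex \<Rightarrow> complex" where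
  "iterate_series a f z = (\<Sum>n. a (Suc n) * (f ^^ Suc n) z)"

end

theory Submission
  imports Defs
begin

text \<open>Put \<open>a = f'(0)\<close>, so that \<open>|a| < 1\<close>. On the circle, \<open>d(z) = z - cnj a * f z\<close> is orthogonal to
  every function of \<open>f\<close>, that is, \<open>cnj a * f\<close> is the conditional expectation of \<open>z\<close> given \<open>f\<close>; hence
  the functions \<open>d \<circ> f^n\<close> are bounded reverse martingale differences, \<open>f^n\<close> being the iterates. Summation by
  parts turns \<open>\<Sum> a_n f^n\<close> into \<open>\<Sum> b_n (d \<circ> f^n)\<close> with \<open>b_n = a_n + cnj a * b_(n-1)\<close>, and the
  \<open>l^2\<close> norms of the two sequences are comparable. The exponential moments of the
  martingale are estimated as in Azuma's inequality, which bounds all \<open>H^p\<close> norms from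
  above; orthogonality bounds the \<open>H^2\<close> norm from below, and interpolation between
  exponents \<open>p\<close>, 2 and 4 gives the lower bound for every \<open>p\<close>.

  Boundary values of the iterates are never used: an integral over the circle of a function of
  \<open>f\<close> is replaced by the limit of its means over circles of radius \<open>r < 1\<close>, and the weight
  \<open>exp (Re S)\<close> of the Azuma argument by \<open>|exp (S / 2)|^2\<close>, so that only square means of
  holomorphic functions occur.\<close>

text \<open>The iterates are orthogonal on the circle only if f'(0) = 0, so the series has to be
  rewritten before orthogonality can help. At the boundary \<open>f\<close> enters only through its
  moments: since \<open>f 0 = 0\<close> and the square means of \<open>f\<close> tend to 1, the
  means of \<open>f z ^ j * cnj (f z ^ k)\<close> tend to those of
  \<open>z ^ j * cnj (z ^ k)\<close>, so that composition with \<open>f\<close> preserves square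
  means of holomorphic functions in the limit. A martingale sum is its first term plus a sum of the
  same shape composed with \<open>f\<close>; hence every induction removes the first term, not the
  last. The composed factor has no useful bound in the supremum norm, only square summable Taylor
  coefficients, and this is what forces weights to be squared moduli of holomorphic functions. That
  \<open>f\<close> is not a rotation is felt three times: |f'(0)| < 1 makes the change of
  coefficients bounded on l^2, it gives the martingale differences the positive variance 1 -
  |f'(0)|^2, and the strict Schwarz inequality makes the iterates decay geometrically on compact
  subsets of the disc.\<close>

section \<open>Integral means over circles\<close>

lemma measurable_cis_circle:
  "cis \<in> measurable (uniform_measure lborel {0..<2 * pi}) (restrict_space borel (sphere 0 1))"
proof (rule measurable_restrict_space2)
  have "cis \<in> borel_measurable borel"
    by (intro borel_measurable_continuous_onI continuous_intros)
  then show "cis \<in> borel_measurable (uniform_measure lborel {0..<2 * pi})"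
    by (subst measurable_cong_sets[where M'=borel and N'=borel]) auto
qed auto

interpretation circle: finite_measure circle_measure
proof -
  interpret U: finite_measure "uniform_measure lborel {0..<2 * pi}"
    by standard (simp add: emeasure_uniform_measure_1)
  show "finite_measure circle_measure"
    unfolding circle_measure_def by (rule U.finite_measure_distr[OF measurable_cis_circle])
qed

lemma space_circle [simp]: "space circle_measure = sphere 0 1"
  by (simp add: circle_measure_def space_restrict_space)

lemma measure_circle [simp]: "measure circle_measure (sphere 0 1) = 1"
proof -
  have "sphere 0 1 \<in> sets circle_measure"
    using sets.top[of circle_measure] by simp
  moreover have "cis -` sphere 0 1 = UNIV"
    by auto
  moreover have "measure (uniform_measure lborel {0..<2 * pi}) UNIV = 1"
    using emeasure_uniform_measure_1[of lborel "{0..<2 * pi}"] by (simp add: measure_def)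
  ultimately show ?thesis
    unfolding circle_measure_def by (subst measure_distr[OF measurable_cis_circle]) auto
qed

lemma borel_measurable_circle:
  fixes g :: "complex \<Rightarrow> 'b::topological_space"
  assumes "continuous_on (sphere 0 1) g"
  shows "g \<in> borel_measurable circle_measure"
proof -
  have "sets circle_measure = sets (restrict_space borel (sphere 0 1))"
    by (simp add: circle_measure_def)
  then show ?thesis
    using borel_measurable_continuous_on_restrict[OF assms] measurable_cong_sets by blast
qed

lemma integrable_circle:
  fixes g :: "complex \<Rightarrow> 'b::{banach,second_countable_topology}"
  assumes "continuous_on (sphere 0 1) g"
  shows "integrable circle_measure g"
proof -
  have "bounded (g ` sphere 0 1)"
    by (intro compact_imp_bounded compact_continuous_image assms compact_sphere)
  then obtain B where "\<forall>x\<in>sphere 0 1. norm (g x) \<le> B"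
    unfolding bounded_iff by auto
  then show ?thesis
    by (intro circle.integrable_const_bound[where B=B] borel_measurable_circle assms) auto
qed

lemma integral_circle_power: "(\<integral>\<xi>. \<xi> ^ n \<partial>circle_measure) = (if n = 0 then 1 else 0)"
proof (cases "n = 0")
  case True
  then show ?thesis by simp
next
  case False
  have [measurable]: "cis \<in> borel_measurable borel"
    by (intro borel_measurable_continuous_onI continuous_intros)
  have "(\<integral>\<xi>. \<xi> ^ n \<partial>circle_measure) = (\<integral>t. cis t ^ n \<partial>uniform_measure lborel {0..<2 * pi})"
    unfolding circle_measure_def
    by (rule integral_distr[OF measurable_cis_circle])
       (intro borel_measurable_continuous_on_restrict continuous_intros)
  also have "\<dots> = (\<integral>t. (indicator {0..<2 * pi} t / (2 * pi)) *\<^sub>R cis t ^ n \<partial>lborel)"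
  proof -
    have "uniform_measure lborel {0..<2 * pi}
        = density lborel (\<lambda>t. ennreal (indicator {0..<2 * pi} t / (2 * pi)))"
      unfolding uniform_measure_def
      by (intro arg_cong2[where f=density] refl ext) (auto simp: divide_ennreal[symmetric] indicator_def)
    then show ?thesis
      by (simp add: integral_density)
  qed
  \<comment> \<open>The endpoint \<open>2 * pi\<close> is a null set; adding it produces the closed
    interval of the fundamental theorem of calculus.\<close>
  also have "\<dots> = (\<integral>t. (1 / (2 * pi)) *\<^sub>R (indicator {0..2 * pi} t *\<^sub>R cis t ^ n) \<partial>lborel)"
  proof (rule integral_cong_AE)
    show "AE t in lborel. (indicator {0..<2 * pi} t / (2 * pi)) *\<^sub>R cis t ^ n
         = (1 / (2 * pi)) *\<^sub>R (indicator {0..2 * pi} t *\<^sub>R cis t ^ n)"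
      using AE_lborel_singleton[of "2 * pi"] by eventually_elim (auto simp: indicator_def)
  qed measurable
  also have "\<dots> = (1 / (2 * pi)) *\<^sub>R (\<integral>t. indicator {0..2 * pi} t *\<^sub>R cis t ^ n \<partial>lborel)"
    by (rule integral_scaleR_right)
  also have "(\<integral>t. indicator {0..2 * pi} t *\<^sub>R cis t ^ n \<partial>lborel)
     = cis (real n * (2 * pi)) / (\<i> * n) - cis (real n * 0) / (\<i> * n)"
  proof (rule integral_FTC_Icc)
    fix t
    have "((\<lambda>z. exp (\<i> * (of_nat n * z)) / (\<i> * of_nat n)) has_field_derivative
        exp (\<i> * (of_nat n * complex_of_real t))) (at (complex_of_real t))"
      using False by (auto intro!: derivative_eq_intros simp: complex_eq_iff)
    note D = has_vector_derivative_real_field[OF this]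
    have E: "exp (\<i> * (of_nat n * complex_of_real s)) = cis (real n * s)" for s
      by (simp add: cis_conv_exp)
    show "((\<lambda>t. cis (real n * t) / (\<i> * n)) has_vector_derivative cis t ^ n)
        (at t within {0..2 * pi})"
      using D unfolding Complex.DeMoivre E by blast
  next
    show "continuous_on {0..2 * pi} (\<lambda>t. cis t ^ n)"
      by (intro continuous_intros)
  qed simp
  also have "\<dots> = 0"
    by (simp add: mult.commute[of "real n"])
  finally show ?thesis using False by simp
qed

text \<open>The value type is general so that the same rules serve complex moments and real square
  means. The Bochner integral is 0 for a non-integrable function, hence the continuity assumptions
  in the rules below.\<close>

definition circle_mean :: "(complex \<Rightarrow> 'b::{banach,second_countable_topology}) \<Rightarrow> real \<Rightarrow> 'b" where
  "circle_mean \<phi> r = (\<integral>\<xi>. \<phi> (complex_of_real r * \<xi>) \<partial>circle_measure)"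

lemma continuous_on_radial:
  assumes "continuous_on (ball 0 1) \<phi>" "0 \<le> r" "r < 1"
  shows "continuous_on (sphere 0 1) (\<lambda>\<xi>. \<phi> (complex_of_real r * \<xi>))"
  by (rule continuous_on_compose2[OF assms(1)])
     (use assms(2,3) in \<open>auto intro!: continuous_intros simp: norm_mult\<close>)

lemma integrable_radial:
  fixes \<phi> :: "complex \<Rightarrow> 'b::{banach,second_countable_topology}"
  assumes "continuous_on (ball 0 1) \<phi>" "0 \<le> r" "r < 1"
  shows "integrable circle_measure (\<lambda>\<xi>. \<phi> (complex_of_real r * \<xi>))"
  by (intro integrable_circle continuous_on_radial assms)

lemma circle_mean_add:
  fixes \<phi> \<psi> :: "complex \<Rightarrow> 'b::{banach,second_countable_topology}"
  assumes "continuous_on (ball 0 1) \<phi>" "continuous_on (ball 0 1) \<psi>" "0 \<le> r" "r < 1"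
  shows "circle_mean (\<lambda>z. \<phi> z + \<psi> z) r = circle_mean \<phi> r + circle_mean \<psi> r"
  unfolding circle_mean_def by (intro Bochner_Integration.integral_add integrable_radial assms)

lemma circle_mean_diff:
  fixes \<phi> \<psi> :: "complex \<Rightarrow> 'b::{banach,second_countable_topology}"
  assumes "continuous_on (ball 0 1) \<phi>" "continuous_on (ball 0 1) \<psi>" "0 \<le> r" "r < 1"
  shows "circle_mean (\<lambda>z. \<phi> z - \<psi> z) r = circle_mean \<phi> r - circle_mean \<psi> r"
  unfolding circle_mean_def by (intro Bochner_Integration.integral_diff integrable_radial assms)

lemma circle_mean_sum:
  fixes \<phi> :: "'i \<Rightarrow> complex \<Rightarrow> 'b::{banach,second_countable_topology}"
  assumes "\<And>i. i \<in> I \<Longrightarrow> continuous_on (ball 0 1) (\<phi> i)" "0 \<le> r" "r < 1"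
  shows "circle_mean (\<lambda>z. \<Sum>i\<in>I. \<phi> i z) r = (\<Sum>i\<in>I. circle_mean (\<phi> i) r)"
  unfolding circle_mean_def by (intro Bochner_Integration.integral_sum integrable_radial assms)

lemma circle_mean_mult_left [simp]:
  fixes \<phi> :: "complex \<Rightarrow> 'b::{real_normed_field,banach,second_countable_topology}"
  shows "circle_mean (\<lambda>z. c * \<phi> z) r = c * circle_mean \<phi> r"
  unfolding circle_mean_def by simp

lemma circle_mean_const [simp]:
  fixes c :: "'b::{banach,second_countable_topology}"
  shows "circle_mean (\<lambda>z. c) r = c"
  unfolding circle_mean_def by (simp add: measure_def[symmetric])

lemma circle_mean_cong:
  assumes "\<And>z. norm z < 1 \<Longrightarrow> \<phi> z = \<psi> z" "0 \<le> r" "r < 1"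
  shows "circle_mean \<phi> r = circle_mean \<psi> r"
  unfolding circle_mean_def
  by (rule Bochner_Integration.integral_cong[OF refl]) (use assms in \<open>auto simp: norm_mult\<close>)

lemma circle_mean_cnj: "circle_mean (\<lambda>z. cnj (\<phi> z)) r = cnj (circle_mean \<phi> r)"
  unfolding circle_mean_def by simp

lemma circle_mean_of_real: "circle_mean (\<lambda>z. of_real (\<phi> z) :: complex) r = of_real (circle_mean \<phi> r)"
  unfolding circle_mean_def by simp

lemma circle_mean_Re:
  assumes "continuous_on (ball 0 1) \<phi>" "0 \<le> r" "r < 1"
  shows "circle_mean (\<lambda>z. Re (\<phi> z)) r = Re (circle_mean \<phi> r)"
  unfolding circle_mean_def by (simp add: integrable_radial[OF assms])

lemma circle_mean_mono:
  fixes \<phi> \<psi> :: "complex \<Rightarrow> real"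
  assumes "continuous_on (ball 0 1) \<phi>" "continuous_on (ball 0 1) \<psi>" "0 \<le> r" "r < 1"
    "\<And>z. norm z < 1 \<Longrightarrow> \<phi> z \<le> \<psi> z"
  shows "circle_mean \<phi> r \<le> circle_mean \<psi> r"
  unfolding circle_mean_def
  by (intro integral_mono integrable_radial assms) (use assms in \<open>auto simp: norm_mult\<close>)

lemma norm_circle_mean_le:
  fixes \<phi> :: "complex \<Rightarrow> 'b::{banach,second_countable_topology}"
  assumes "continuous_on (ball 0 1) \<phi>" "continuous_on (ball 0 1) \<psi>" "0 \<le> r" "r < 1"
    "\<And>z. norm z < 1 \<Longrightarrow> norm (\<phi> z) \<le> \<psi> z"
  shows "norm (circle_mean \<phi> r) \<le> circle_mean \<psi> r"
proof -
  have "norm (circle_mean \<phi> r) \<le> circle_mean (\<lambda>z. norm (\<phi> z)) r"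
    unfolding circle_mean_def by (rule integral_norm_bound)
  also have "\<dots> \<le> circle_mean \<psi> r"
    by (intro circle_mean_mono continuous_intros assms)
  finally show ?thesis .
qed

section \<open>Taylor coefficients, Parseval's identity and square means\<close>

text \<open>Together with square summability of \<open>c\<close> this stands for membership of
  \<open>g\<close> in the Hardy space of exponent 2, with the sum of the squares as squared norm; no
  boundary function has to be named.\<close>

definition taylor :: "(nat \<Rightarrow> complex) \<Rightarrow> (complex \<Rightarrow> complex) \<Rightarrow> bool" where
  "taylor c g \<longleftrightarrow> (\<forall>z. norm z < 1 \<longrightarrow> (\<lambda>n. c n * z ^ n) sums g z)"

lemma holomorphic_imp_taylor:
  assumes "g holomorphic_on ball 0 1"
  obtains c where "taylor c g" "c 0 = g 0" "c 1 = deriv g 0"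
proof
  show "taylor (\<lambda>n. (deriv ^^ n) g 0 / fact n) g"
    unfolding taylor_def using holomorphic_power_series[OF assms] by auto
qed auto

lemma taylor_holomorphic:
  assumes "taylor c g"
  shows "g holomorphic_on ball 0 1"
  by (rule power_series_holomorphic[where a=c]) (use assms in \<open>auto simp: taylor_def\<close>)

text \<open>Convergence at the larger radius \<open>(1 + r) / 2\<close> forces absolute convergence
  at \<open>r\<close>.\<close>

lemma taylor_abs_summable:
  assumes "taylor c g" "0 \<le> r" "r < 1"
  shows "summable (\<lambda>n. norm (c n) * r ^ n)"
proof -
  have "summable (\<lambda>n. c n * (of_real ((1 + r) / 2)) ^ n)"
    using assms sums_summable unfolding taylor_def by (force simp del: of_real_divide of_real_add)
  moreover have "norm (complex_of_real r) < norm (complex_of_real ((1 + r) / 2))"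
    unfolding norm_of_real using assms by simp
  ultimately have "summable (\<lambda>n. norm (c n * complex_of_real r ^ n))"
    by (rule powser_insidea)
  then show ?thesis
    using assms by (simp add: norm_mult norm_power)
qed

text \<open>Termwise integration against a bounded weight. The weights 1,
  \<open>cnj (\<xi> ^ n)\<close> and the conjugate of \<open>g\<close> itself yield the mean value
  property, the coefficient formula and Parseval's identity.\<close>

lemma taylor_mean_mult:
  assumes c: "taylor c g" and r: "0 \<le> r" "r < 1" and \<gamma>: "continuous_on (sphere 0 1) \<gamma>"
  shows "(\<lambda>n. c n * of_real r ^ n * (\<integral>\<xi>. \<xi> ^ n * \<gamma> \<xi> \<partial>circle_measure)) sums
           (\<integral>\<xi>. g (of_real r * \<xi>) * \<gamma> \<xi> \<partial>circle_measure)"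
proof -
  define F where "F n \<xi> = c n * of_real r ^ n * (\<xi> ^ n * \<gamma> \<xi>)" for n \<xi>
  have "bounded (\<gamma> ` sphere 0 1)"
    by (intro compact_imp_bounded compact_continuous_image \<gamma> compact_sphere)
  then obtain B where B: "\<forall>\<xi>\<in>sphere 0 1. norm (\<gamma> \<xi>) \<le> B"
    unfolding bounded_iff by auto
  have int: "integrable circle_measure (F n)" for n
    unfolding F_def by (intro integrable_circle continuous_intros \<gamma>)
  have bd: "norm (F n \<xi>) \<le> norm (c n) * r ^ n * B" if "\<xi> \<in> sphere 0 1" for n \<xi>
    unfolding F_def using that r B by (simp add: norm_mult norm_power mult_left_mono)
  have sm: "summable (\<lambda>n. norm (c n) * r ^ n * B)"
    by (intro summable_mult2 taylor_abs_summable[OF c r])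
  have AE: "AE \<xi> in circle_measure. summable (\<lambda>n. norm (F n \<xi>))"
    by (intro AE_I2 summable_comparison_test'[OF sm]) (use bd in simp)
  have sI: "summable (\<lambda>n. \<integral>\<xi>. norm (F n \<xi>) \<partial>circle_measure)"
  proof (rule summable_comparison_test'[OF sm])
    fix n
    have "(\<integral>\<xi>. norm (F n \<xi>) \<partial>circle_measure) \<le> (\<integral>\<xi>. norm (c n) * r ^ n * B \<partial>circle_measure)"
      using bd by (intro integral_mono int integrable_norm) auto
    then show "norm (\<integral>\<xi>. norm (F n \<xi>) \<partial>circle_measure) \<le> norm (c n) * r ^ n * B"
      by simp
  qed
  have "(\<lambda>n. \<integral>\<xi>. F n \<xi> \<partial>circle_measure) sums (\<integral>\<xi>. (\<Sum>n. F n \<xi>) \<partial>circle_measure)"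
    by (rule sums_integral[OF int AE sI])
  also have "(\<integral>\<xi>. (\<Sum>n. F n \<xi>) \<partial>circle_measure) = (\<integral>\<xi>. g (of_real r * \<xi>) * \<gamma> \<xi> \<partial>circle_measure)"
  proof (rule Bochner_Integration.integral_cong[OF refl])
    fix \<xi> assume "\<xi> \<in> space circle_measure"
    then have "(\<lambda>n. c n * (of_real r * \<xi>) ^ n) sums g (of_real r * \<xi>)"
      using c r by (simp add: taylor_def norm_mult)
    from sums_mult2[OF this, of "\<gamma> \<xi>"] show "(\<Sum>n. F n \<xi>) = g (of_real r * \<xi>) * \<gamma> \<xi>"
      unfolding F_def by (simp add: power_mult_distrib mult_ac sums_iff)
  qed
  finally show ?thesis
    unfolding F_def by simp
qed

lemma taylor_mean_value:
  assumes "taylor c g" "0 \<le> r" "r < 1"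
  shows "circle_mean g r = c 0"
proof -
  have "(\<lambda>n. c n * of_real r ^ n * (\<integral>\<xi>. \<xi> ^ n * 1 \<partial>circle_measure)) sums
           (\<integral>\<xi>. g (of_real r * \<xi>) * 1 \<partial>circle_measure)"
    by (intro taylor_mean_mult assms continuous_intros)
  moreover have "(\<lambda>n. c n * of_real r ^ n * (\<integral>\<xi>. \<xi> ^ n * 1 \<partial>circle_measure))
      = (\<lambda>n. if n = 0 then c n else 0)"
    by (auto simp: integral_circle_power)
  ultimately show ?thesis
    using sums_single[of 0 c] unfolding circle_mean_def by (simp add: sums_iff)
qed

lemma taylor_coeff_integral:
  assumes "taylor c g" "0 \<le> r" "r < 1"
  shows "(\<integral>\<xi>. g (of_real r * \<xi>) * cnj (\<xi> ^ n) \<partial>circle_measure) = c n * of_real r ^ n"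
proof -
  have orth: "(\<integral>\<xi>. \<xi> ^ k * cnj (\<xi> ^ n) \<partial>circle_measure) = (if k = n then 1 else 0)" for k
  proof (cases "n \<le> k")
    case True
    have "(\<integral>\<xi>. \<xi> ^ k * cnj (\<xi> ^ n) \<partial>circle_measure) = (\<integral>\<xi>. \<xi> ^ (k - n) \<partial>circle_measure)"
    proof (rule Bochner_Integration.integral_cong[OF refl])
      fix \<xi> assume "\<xi> \<in> space circle_measure"
      then have "\<xi> * cnj \<xi> = 1"
        by (simp add: complex_norm_square[symmetric])
      then have "\<xi> ^ n * cnj (\<xi> ^ n) = 1"
        by (simp flip: power_mult_distrib)
      moreover have "\<xi> ^ k = \<xi> ^ (k - n) * \<xi> ^ n"
        using True by (simp flip: power_add)
      ultimately show "\<xi> ^ k * cnj (\<xi> ^ n) = \<xi> ^ (k - n)"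
        by (simp add: mult.assoc)
    qed
    with True show ?thesis by (auto simp: integral_circle_power)
  next
    case False
    have "(\<integral>\<xi>. \<xi> ^ k * cnj (\<xi> ^ n) \<partial>circle_measure) = (\<integral>\<xi>. cnj (\<xi> ^ (n - k)) \<partial>circle_measure)"
    proof (rule Bochner_Integration.integral_cong[OF refl])
      fix \<xi> assume "\<xi> \<in> space circle_measure"
      then have "\<xi> * cnj \<xi> = 1"
        by (simp add: complex_norm_square[symmetric])
      then have "\<xi> ^ k * cnj (\<xi> ^ k) = 1"
        by (simp flip: power_mult_distrib)
      moreover have "cnj (\<xi> ^ n) = cnj (\<xi> ^ k) * cnj (\<xi> ^ (n - k))"
        using False by (simp flip: power_add)
      ultimately show "\<xi> ^ k * cnj (\<xi> ^ n) = cnj (\<xi> ^ (n - k))"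
        by (simp add: mult.assoc[symmetric])
    qed
    also have "\<dots> = cnj (\<integral>\<xi>. \<xi> ^ (n - k) \<partial>circle_measure)"
      by (rule Bochner_Integration.integral_cnj)
    finally show ?thesis
      using False by (simp add: integral_circle_power)
  qed
  have "(\<lambda>k. c k * of_real r ^ k * (\<integral>\<xi>. \<xi> ^ k * cnj (\<xi> ^ n) \<partial>circle_measure)) sums
           (\<integral>\<xi>. g (of_real r * \<xi>) * cnj (\<xi> ^ n) \<partial>circle_measure)"
    by (intro taylor_mean_mult assms continuous_intros)
  moreover have "(\<lambda>k. c k * of_real r ^ k * (\<integral>\<xi>. \<xi> ^ k * cnj (\<xi> ^ n) \<partial>circle_measure))
      = (\<lambda>k. if k = n then c k * of_real r ^ k else 0)"
    unfolding orth by auto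
  ultimately show ?thesis
    using sums_single[of n "\<lambda>k. c k * of_real r ^ k"] by (simp add: sums_iff)
qed

text \<open>The weight \<open>cnj z\<close> selects the linear coefficient, and through it
  derivatives at the origin enter the moments. One factor \<open>r\<close> comes from the series and
  one from the weight.\<close>

lemma circle_mean_mult_cnj:
  assumes "taylor c g" "0 \<le> r" "r < 1"
  shows "circle_mean (\<lambda>z. g z * cnj z) r = c 1 * of_real (r\<^sup>2)"
proof -
  have "circle_mean (\<lambda>z. g z * cnj z) r
      = (\<integral>\<xi>. of_real r * (g (of_real r * \<xi>) * cnj (\<xi> ^ 1)) \<partial>circle_measure)"
    unfolding circle_mean_def by (simp add: mult_ac)
  also have "\<dots> = of_real r * (c 1 * of_real r ^ 1)"
    by (subst integral_mult_right_zero, subst taylor_coeff_integral[OF assms]) simp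
  finally show ?thesis by (simp add: power2_eq_square mult_ac)
qed

text \<open>Only one of the two factors is expanded; each resulting integral is the conjugate of a
  coefficient integral of \<open>g\<close>.\<close>

lemma parseval:
  assumes c: "taylor c g" and r: "0 \<le> r" "r < 1"
  shows "(\<lambda>n. (norm (c n))\<^sup>2 * r ^ (2 * n)) sums circle_mean (\<lambda>z. (norm (g z))\<^sup>2) r"
proof -
  have contg: "continuous_on (sphere 0 1) (\<lambda>\<xi>. g (of_real r * \<xi>))"
    by (intro continuous_on_radial r holomorphic_on_imp_continuous_on taylor_holomorphic[OF c])
  have "(\<lambda>n. c n * of_real r ^ n * (\<integral>\<xi>. \<xi> ^ n * cnj (g (of_real r * \<xi>)) \<partial>circle_measure)) sums
           (\<integral>\<xi>. g (of_real r * \<xi>) * cnj (g (of_real r * \<xi>)) \<partial>circle_measure)"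
    by (intro taylor_mean_mult[OF c r] continuous_intros contg)
  also have "(\<integral>\<xi>. g (of_real r * \<xi>) * cnj (g (of_real r * \<xi>)) \<partial>circle_measure)
      = of_real (circle_mean (\<lambda>z. (norm (g z))\<^sup>2) r)"
    unfolding circle_mean_def
    by (simp only: complex_norm_square[symmetric] integral_complex_of_real)
  also have "(\<lambda>n. c n * of_real r ^ n * (\<integral>\<xi>. \<xi> ^ n * cnj (g (of_real r * \<xi>)) \<partial>circle_measure))
      = (\<lambda>n. of_real ((norm (c n))\<^sup>2 * r ^ (2 * n)))"
  proof
    fix n
    have "(\<integral>\<xi>. \<xi> ^ n * cnj (g (of_real r * \<xi>)) \<partial>circle_measure)
        = (\<integral>\<xi>. cnj (g (of_real r * \<xi>) * cnj (\<xi> ^ n)) \<partial>circle_measure)"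
      by (simp add: mult.commute)
    also have "\<dots> = cnj (c n * of_real r ^ n)"
      unfolding Bochner_Integration.integral_cnj taylor_coeff_integral[OF c r] ..
    finally show "c n * of_real r ^ n * (\<integral>\<xi>. \<xi> ^ n * cnj (g (of_real r * \<xi>)) \<partial>circle_measure)
        = of_real ((norm (c n))\<^sup>2 * r ^ (2 * n))"
      unfolding of_real_mult complex_norm_square by (simp add: mult_ac power_mult power2_eq_square)
  qed
  finally show ?thesis
    by (simp only: sums_of_real_iff)
qed

text \<open>Every Parseval term increases with the radius. A limit at radius 1 therefore bounds the
  mean at each fixed radius.\<close>

lemma square_mean_mono:
  assumes g: "g holomorphic_on ball 0 1" and "0 \<le> r" "r \<le> s" "s < 1"
  shows "circle_mean (\<lambda>z. (norm (g z))\<^sup>2) r \<le> circle_mean (\<lambda>z. (norm (g z))\<^sup>2) s"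
proof -
  obtain c where c: "taylor c g"
    using g holomorphic_imp_taylor by blast
  show ?thesis
    by (rule sums_le[OF _ parseval[OF c] parseval[OF c]])
       (use assms in \<open>auto intro!: mult_left_mono power_mono\<close>)
qed

lemma square_mean_le_suminf:
  assumes c: "taylor c g" "summable (\<lambda>n. (norm (c n))\<^sup>2)" and r: "0 \<le> r" "r < 1"
  shows "circle_mean (\<lambda>z. (norm (g z))\<^sup>2) r \<le> (\<Sum>n. (norm (c n))\<^sup>2)"
proof (rule sums_le[OF _ parseval[OF c(1) r] summable_sums[OF c(2)]])
  fix n
  have "r ^ (2 * n) \<le> 1"
    using r by (simp add: power_le_one)
  then show "(norm (c n))\<^sup>2 * r ^ (2 * n) \<le> (norm (c n))\<^sup>2"
    by (simp add: mult_left_le)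
qed

text \<open>Let the radius tend to 1 in a finite partial sum of Parseval's identity, then let the
  partial sum grow.\<close>

lemma bounded_square_mean:
  assumes c: "taylor c g"
    and K: "\<And>r. 0 \<le> r \<Longrightarrow> r < 1 \<Longrightarrow> circle_mean (\<lambda>z. (norm (g z))\<^sup>2) r \<le> K"
  shows "summable (\<lambda>n. (norm (c n))\<^sup>2)" "(\<Sum>n. (norm (c n))\<^sup>2) \<le> K"
proof -
  have bound: "(\<Sum>k<n. (norm (c k))\<^sup>2) \<le> K" for n
  proof -
    have "(\<Sum>k<n. (norm (c k))\<^sup>2 * r ^ (2 * k)) \<le> K" if "0 \<le> r" "r < 1" for r
      using sum_le_suminf[OF sums_summable[OF parseval[OF c that]], of "{..<n}"]
        K[OF that] sums_unique[OF parseval[OF c that]] that by simp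
    then have "\<forall>\<^sub>F r in at_left 1. (\<Sum>k<n. (norm (c k))\<^sup>2 * r ^ (2 * k)) \<le> K"
      by (intro eventually_at_leftI[of 0]) auto
    moreover have "((\<lambda>r. \<Sum>k<n. (norm (c k))\<^sup>2 * r ^ (2 * k))
        \<longlongrightarrow> (\<Sum>k<n. (norm (c k))\<^sup>2 * 1 ^ (2 * k))) (at_left 1)"
      by (intro tendsto_intros)
    ultimately show ?thesis
      using tendsto_upperbound by fastforce
  qed
  show summable: "summable (\<lambda>n. (norm (c n))\<^sup>2)"
    by (rule summableI_nonneg_bounded[OF _ bound]) simp
  show "(\<Sum>n. (norm (c n))\<^sup>2) \<le> K"
    by (rule suminf_le_const[OF summable bound])
qed

lemma circle_mean_tendsto:
  fixes \<psi> :: "complex \<Rightarrow> 'b::{banach,second_countable_topology}"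
  assumes "\<And>n. continuous_on (ball 0 1) (\<phi> n)" "continuous_on (ball 0 1) \<psi>" "0 \<le> r" "r < 1"
    and "\<And>z. norm z = r \<Longrightarrow> (\<lambda>n. \<phi> n z) \<longlonglongrightarrow> \<psi> z"
    and "\<And>n z. norm z = r \<Longrightarrow> norm (\<phi> n z) \<le> B"
  shows "(\<lambda>n. circle_mean (\<phi> n) r) \<longlonglongrightarrow> circle_mean \<psi> r"
  unfolding circle_mean_def
  by (rule integral_dominated_convergence[where w="\<lambda>_. B"])
     (use assms in \<open>auto intro!: borel_measurable_circle continuous_on_radial AE_I2 simp: norm_mult\<close>)

lemma eventually_at_left_1:
  fixes P :: "real \<Rightarrow> bool"
  assumes "\<And>r. 0 \<le> r \<Longrightarrow> r < 1 \<Longrightarrow> P r"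
  shows "eventually P (at_left 1)"
  by (rule eventually_at_leftI[of 0]) (use assms in auto)

lemma holomorphic_mean_value:
  assumes "g holomorphic_on ball 0 1" "0 \<le> r" "r < 1"
  shows "circle_mean g r = g 0"
  using holomorphic_imp_taylor[OF assms(1)] taylor_mean_value[OF _ assms(2,3)] by metis

lemma tendsto_at_left_1_cong:
  fixes g h :: "real \<Rightarrow> 'b::topological_space"
  assumes "(g \<longlongrightarrow> l) (at_left 1)" "\<And>r. 0 \<le> r \<Longrightarrow> r < 1 \<Longrightarrow> g r = h r"
  shows "(h \<longlongrightarrow> l) (at_left 1)"
  by (rule Lim_transform_eventually[OF assms(1)]) (rule eventually_at_left_1[OF assms(2)])

lemma taylor_tail:
  assumes "taylor c g"
  shows "taylor (\<lambda>n. if n < N then 0 else c n) (\<lambda>z. g z - (\<Sum>n<N. c n * z ^ n))"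
  unfolding taylor_def
proof (intro allI impI)
  fix z :: complex assume z: "norm z < 1"
  have "(\<lambda>n. c n * z ^ n - (if n \<in> {..<N} then c n * z ^ n else 0)) sums (g z - (\<Sum>n<N. c n * z ^ n))"
    by (intro sums_diff sums_If_finite_set) (use assms z in \<open>auto simp: taylor_def\<close>)
  moreover have "(\<lambda>n. c n * z ^ n - (if n \<in> {..<N} then c n * z ^ n else 0))
      = (\<lambda>n. (if n < N then 0 else c n) * z ^ n)"
    by auto
  ultimately show "(\<lambda>n. (if n < N then 0 else c n) * z ^ n) sums (g z - (\<Sum>n<N. c n * z ^ n))"
    by simp
qed

lemma tail_square_sums:
  fixes c :: "nat \<Rightarrow> complex"
  assumes "summable (\<lambda>n. (norm (c n))\<^sup>2)"
  shows "(\<lambda>n. (norm (if n < N then 0 else c n))\<^sup>2) sums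
           ((\<Sum>n. (norm (c n))\<^sup>2) - (\<Sum>n<N. (norm (c n))\<^sup>2))"
proof -
  have "(\<lambda>n. (norm (c n))\<^sup>2 - (if n \<in> {..<N} then (norm (c n))\<^sup>2 else 0)) sums
      ((\<Sum>n. (norm (c n))\<^sup>2) - (\<Sum>n<N. (norm (c n))\<^sup>2))"
    by (intro sums_diff sums_If_finite_set summable_sums assms) auto
  moreover have "(\<lambda>n. (norm (c n))\<^sup>2 - (if n \<in> {..<N} then (norm (c n))\<^sup>2 else 0))
      = (\<lambda>n. (norm (if n < N then 0 else c n))\<^sup>2)"
    by auto
  ultimately show ?thesis by simp
qed

section \<open>Elementary inequalities\<close>

text \<open>With d = |x - y| the left side is at most d (2 |x| + d), and 2 |x| d is split by the
  weighted inequality of arithmetic and geometric means. In approximation arguments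
  \<open>\<epsilon>\<close> makes the first term small, and the distance of the approximant the
  second.\<close>

lemma abs_square_diff_le:
  fixes x y :: "'a::real_normed_vector"
  assumes "0 < \<epsilon>"
  shows "\<bar>(norm x)\<^sup>2 - (norm y)\<^sup>2\<bar> \<le> \<epsilon> * (norm x)\<^sup>2 + (1 + 1 / \<epsilon>) * (norm (x - y))\<^sup>2"
proof -
  define a b d where "a = norm x" "b = norm y" "d = norm (x - y)"
  have abd: "\<bar>a - b\<bar> \<le> d" "0 \<le> a" "0 \<le> b" "0 \<le> d"
    unfolding a_b_d_def by (auto simp: norm_triangle_ineq3)
  have "\<bar>a\<^sup>2 - b\<^sup>2\<bar> = \<bar>a - b\<bar> * (a + b)"
    using abd by (simp add: power2_eq_square square_diff_square_factored abs_mult)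
  also have "\<dots> \<le> d * (2 * a + d)"
    using abd by (intro mult_mono) auto
  also have "\<dots> \<le> \<epsilon> * a\<^sup>2 + (1 + 1 / \<epsilon>) * d\<^sup>2"
  proof -
    have "0 \<le> (\<epsilon> * a - d)\<^sup>2 / \<epsilon>"
      using assms by simp
    also have "\<dots> = \<epsilon> * a\<^sup>2 - 2 * a * d + d\<^sup>2 / \<epsilon>"
      using assms by (simp add: power2_eq_square field_simps)
    finally show ?thesis
      by (simp add: power2_eq_square algebra_simps)
  qed
  finally show ?thesis
    unfolding a_b_d_def .
qed

text \<open>For negative \<open>x = - y\<close> the claim is passed to the reciprocal: the quadratic
  Taylor polynomial of \<open>exp y\<close> times \<open>1 - y + y\<^sup>2\<close> is at least 1.
  The linear term must survive with coefficient exactly 1, because it is the one that cancels in the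
  Azuma step.\<close>

lemma exp_le_quadratic:
  fixes x :: real
  assumes "\<bar>x\<bar> \<le> 1"
  shows "exp x \<le> 1 + x + x\<^sup>2"
proof (cases "0 \<le> x")
  case True
  then show ?thesis using exp_bound[of x] assms by simp
next
  case False
  define y where "y = - x"
  have y: "0 \<le> y" using False by (simp add: y_def)
  have "1 \<le> (1 + y + y\<^sup>2 / 2) * (1 - y + y\<^sup>2)"
  proof -
    have "(1 + y + y\<^sup>2 / 2) * (1 - y + y\<^sup>2) = 1 + y\<^sup>2 / 2 + y ^ 3 / 2 + y ^ 4 / 2"
      by (simp add: power2_eq_square power3_eq_cube power4_eq_xxxx field_simps)
    then show ?thesis using y by simp
  qed
  also have "\<dots> \<le> exp y * (1 - y + y\<^sup>2)"
  proof (rule mult_right_mono)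
    show "1 + y + y\<^sup>2 / 2 \<le> exp y"
      using exp_lower_Taylor_quadratic[OF y] by simp
    have "0 \<le> (1 - y / 2)\<^sup>2 + 3 / 4 * y\<^sup>2" by simp
    also have "\<dots> = 1 - y + y\<^sup>2"
      by (simp add: power2_eq_square field_simps)
    finally show "0 \<le> 1 - y + y\<^sup>2" .
  qed
  finally show ?thesis
    by (simp add: y_def exp_minus field_simps)
qed

lemma square_summable_bound:
  fixes \<beta> :: "nat \<Rightarrow> complex"
  assumes "summable (\<lambda>n. (norm (\<beta> n))\<^sup>2)"
  shows "norm (\<beta> n) \<le> sqrt (\<Sum>n. (norm (\<beta> n))\<^sup>2)"
  using sum_le_suminf[OF assms, of "{n}"] by (intro real_le_rsqrt) simp

lemma continuous_on_norm_powr: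
  fixes g :: "'a::topological_space \<Rightarrow> 'b::real_normed_vector"
  assumes "continuous_on S g" "0 < p"
  shows "continuous_on S (\<lambda>z. norm (g z) powr p)"
  by (intro continuous_on_powr' continuous_intros assms) (use assms in auto)

lemma norm_exp_half: "(norm (exp (w / 2)))\<^sup>2 = exp (Re w)"
  by (simp add: norm_exp_eq_Re power2_eq_square flip: exp_add)

lemma norm_powr_2: "norm w powr 2 = (norm w)\<^sup>2"
  by (cases "w = 0") (simp_all add: powr_numeral)

text \<open>The larger of |Re w| and |Im w| is the real part of \<open>u * w\<close> for one of the
  four units \<open>u\<close>, so exponential means of real parts control every power mean. The
  factors \<open>1\<close> and \<open>- 1\<close> are written out to give all four summands the same
  shape.\<close>

lemma norm_powr_le_exp:
  assumes "0 < p"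
  obtains C :: real where "0 < C" "\<And>w::complex. norm w powr p \<le>
    C * (exp (Re (1 * w)) + exp (Re (- 1 * w)) + exp (Re (\<i> * w)) + exp (Re (- \<i> * w)))"
proof -
  obtain n :: nat where n: "p \<le> real n"
    using real_arch_simple by blast
  \<comment> \<open>The summand 1 covers \<open>x \<le> 1\<close>; \<open>fact n\<close> comes from
    the \<open>n\<close>-th term of the exponential series and covers \<open>x > 1\<close>.\<close>
  have base: "x powr p \<le> (1 + fact n) * exp x" if "0 \<le> x" for x :: real
  proof (cases "x \<le> 1")
    case True
    then have "x powr p \<le> 1 powr p"
      using that assms by (intro powr_mono2) auto
    also have "\<dots> \<le> (1 + fact n) * 1" by simp
    also have "\<dots> \<le> (1 + fact n) * exp x"
      using that by (intro mult_left_mono) auto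
    finally show ?thesis .
  next
    case False
    then have "x powr p \<le> x powr n"
      using n by (intro powr_mono) auto
    also have "\<dots> = fact n * (x ^ n / fact n)"
      using False by (simp add: powr_realpow)
    also have "\<dots> \<le> fact n * exp x"
    proof (rule mult_left_mono)
      have "(\<Sum>k\<in>{n}. inverse (fact k) *\<^sub>R x ^ k) \<le> (\<Sum>k. inverse (fact k) *\<^sub>R x ^ k)"
        by (rule sum_le_suminf[OF summable_exp_generic]) (use that in auto)
      then show "x ^ n / fact n \<le> exp x"
        by (simp add: exp_def field_simps)
    qed simp
    also have "\<dots> \<le> (1 + fact n) * exp x"
      by (intro mult_right_mono) auto
    finally show ?thesis .
  qed
  show ?thesis
  proof
    show "0 < 2 powr p * (1 + fact n :: real)"
      by (intro mult_pos_pos add_pos_pos) auto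
    fix w :: complex
    define m where "m = max \<bar>Re w\<bar> \<bar>Im w\<bar>"
    have "norm w \<le> \<bar>Re w\<bar> + \<bar>Im w\<bar>" by (rule cmod_le)
    then have m: "norm w \<le> 2 * m" "0 \<le> m" by (auto simp: m_def)
    have "norm w powr p \<le> (2 * m) powr p"
      using m assms by (intro powr_mono2) auto
    also have "\<dots> = 2 powr p * m powr p"
      using m by (simp add: powr_mult)
    also have "\<dots> \<le> 2 powr p * ((1 + fact n) * exp m)"
      using base m by (intro mult_left_mono) auto
    also have "\<dots> \<le> 2 powr p * ((1 + fact n) *
        (exp (Re (1 * w)) + exp (Re (- 1 * w)) + exp (Re (\<i> * w)) + exp (Re (- \<i> * w))))"
    proof (intro mult_left_mono)
      have "m = Re w \<or> m = - Re w \<or> m = Im w \<or> m = - Im w"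
        unfolding m_def by linarith
      moreover have "0 < exp (Re w)" "0 < exp (- Re w)" "0 < exp (Im w)" "0 < exp (- Im w)"
        by simp_all
      ultimately show "exp m \<le> exp (Re (1 * w)) + exp (Re (- 1 * w)) + exp (Re (\<i> * w)) + exp (Re (- \<i> * w))"
        by (elim disjE) (simp_all del: exp_gt_zero)
    qed auto
    finally show "norm w powr p \<le> 2 powr p * (1 + fact n) *
        (exp (Re (1 * w)) + exp (Re (- 1 * w)) + exp (Re (\<i> * w)) + exp (Re (- \<i> * w)))"
      by (simp only: mult.assoc)
  qed
qed

section \<open>Boundary moments of inner functions\<close>

text \<open>The radial limits of an inner function are condensed into the last assumption, the only
  boundary information that the argument uses; \<open>inner_function_square_mean\<close> supplies
  it.\<close>

locale inner_fixing_origin =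
  fixes f :: "complex \<Rightarrow> complex"
  assumes holf: "f holomorphic_on ball 0 1"
    and f_lt_1: "norm z < 1 \<Longrightarrow> norm (f z) < 1"
    and f_0: "f 0 = 0"
    and square_mean_f: "(circle_mean (\<lambda>z. (norm (f z))\<^sup>2) \<longlongrightarrow> 1) (at_left 1)"
begin

lemma contf: "continuous_on (ball 0 1) f"
  by (rule holomorphic_on_imp_continuous_on[OF holf])

lemma norm_f_le: "norm z < 1 \<Longrightarrow> norm (f z) \<le> norm z"
  using Schwarz_Lemma(1)[OF holf f_0 f_lt_1] by blast

lemma holomorphic_compose:
  assumes "g holomorphic_on ball 0 1"
  shows "(\<lambda>z. g (f z)) holomorphic_on ball 0 1"
proof -
  have "f ` ball 0 1 \<subseteq> ball 0 1"
    using f_lt_1 by auto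
  then show ?thesis
    using holomorphic_on_compose_gen[OF holf assms] by (simp add: o_def)
qed

lemma continuous_compose:
  assumes "continuous_on (ball 0 1) g"
  shows "continuous_on (ball 0 1) (\<lambda>z. g (f z))"
  by (rule continuous_on_compose2[OF assms contf]) (use f_lt_1 in auto)

text \<open>On the circle \<open>cnj (f z) = 1 / f z\<close>; inside the disc the error is controlled by
  \<open>1 - |f z|^2\<close>, whose circle means vanish in the limit.\<close>

lemma moment_reduce:
  assumes \<phi>: "continuous_on (ball 0 1) \<phi>" "\<And>z. norm z < 1 \<Longrightarrow> norm (\<phi> z) \<le> B" and "k \<le> j"
  shows "((\<lambda>r. circle_mean (\<lambda>z. \<phi> z * (f z ^ j * cnj (f z ^ k))) r
              - circle_mean (\<lambda>z. \<phi> z * f z ^ (j - k)) r) \<longlongrightarrow> 0) (at_left 1)"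
proof (rule Lim_null_comparison)
  have le: "norm (\<phi> z * (f z ^ j * cnj (f z ^ k)) - \<phi> z * f z ^ (j - k))
      \<le> B * k * (1 - (norm (f z))\<^sup>2)" if z: "norm z < 1" for z
  proof -
    define x where "x = (norm (f z))\<^sup>2"
    have x: "0 \<le> x" "x \<le> 1"
      using f_lt_1[OF z] by (auto simp: x_def power_le_one)
    have "f z ^ j * cnj (f z ^ k) = f z ^ (j - k) * (f z ^ k * cnj (f z ^ k))"
      using \<open>k \<le> j\<close> by (simp flip: mult.assoc power_add)
    also have "f z ^ k * cnj (f z ^ k) = of_real (x ^ k)"
      using complex_norm_square[of "f z"] by (simp add: x_def power_mult_distrib)
    finally have "\<phi> z * (f z ^ j * cnj (f z ^ k)) - \<phi> z * f z ^ (j - k)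
        = \<phi> z * (f z ^ (j - k) * of_real (x ^ k - 1))"
      by (simp add: algebra_simps)
    then have "norm (\<phi> z * (f z ^ j * cnj (f z ^ k)) - \<phi> z * f z ^ (j - k))
        = norm (\<phi> z) * (norm (f z) ^ (j - k) * (1 - x ^ k))"
      using x by (simp add: norm_mult norm_power power_le_one del: of_real_power of_real_diff)
    also have "\<dots> \<le> B * (1 * (k * (1 - x)))"
    proof (intro mult_mono)
      show "norm (f z) ^ (j - k) \<le> 1"
        using f_lt_1[OF z] by (simp add: power_le_one)
      \<comment> \<open>Bernoulli's inequality reduces the defect of the \<open>k\<close>-th power
        to \<open>k\<close> times the defect of \<open>x = (norm (f z))\<^sup>2\<close>, whose mean
        tends to 0.\<close>
      show "1 - x ^ k \<le> k * (1 - x)"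
        using Bernoulli_inequality[of "x - 1" k] x by (simp add: algebra_simps)
      show "0 \<le> B"
        using \<phi>(2)[OF z] norm_ge_zero order_trans by blast
    qed (use \<phi>(2) z x in \<open>auto simp: power_le_one\<close>)
    finally show ?thesis by (simp add: x_def)
  qed
  show "\<forall>\<^sub>F r in at_left 1. norm (circle_mean (\<lambda>z. \<phi> z * (f z ^ j * cnj (f z ^ k))) r
              - circle_mean (\<lambda>z. \<phi> z * f z ^ (j - k)) r)
          \<le> B * k * (1 - circle_mean (\<lambda>z. (norm (f z))\<^sup>2) r)"
  proof (rule eventually_at_leftI[of 0])
    fix r :: real assume "r \<in> {0<..<1}"
    then have r: "0 \<le> r" "r < 1" by auto
    have "norm (circle_mean (\<lambda>z. \<phi> z * (f z ^ j * cnj (f z ^ k)) - \<phi> z * f z ^ (j - k)) r)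
        \<le> circle_mean (\<lambda>z. B * k * (1 - (norm (f z))\<^sup>2)) r"
      by (rule norm_circle_mean_le) (intro continuous_intros \<phi>(1) contf r le; assumption)+
    also have "\<dots> = B * k * (1 - circle_mean (\<lambda>z. (norm (f z))\<^sup>2) r)"
      by (simp add: circle_mean_diff r continuous_intros contf)
    also have "circle_mean (\<lambda>z. \<phi> z * (f z ^ j * cnj (f z ^ k)) - \<phi> z * f z ^ (j - k)) r
        = circle_mean (\<lambda>z. \<phi> z * (f z ^ j * cnj (f z ^ k))) r - circle_mean (\<lambda>z. \<phi> z * f z ^ (j - k)) r"
      by (intro circle_mean_diff continuous_intros \<phi>(1) contf r)
    finally show "norm (circle_mean (\<lambda>z. \<phi> z * (f z ^ j * cnj (f z ^ k))) r
              - circle_mean (\<lambda>z. \<phi> z * f z ^ (j - k)) r)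
          \<le> B * k * (1 - circle_mean (\<lambda>z. (norm (f z))\<^sup>2) r)" .
  qed simp
  have "((\<lambda>r. B * k * (1 - circle_mean (\<lambda>z. (norm (f z))\<^sup>2) r)) \<longlongrightarrow> B * k * (1 - 1)) (at_left 1)"
    by (intro tendsto_intros square_mean_f)
  then show "((\<lambda>r. B * k * (1 - circle_mean (\<lambda>z. (norm (f z))\<^sup>2) r)) \<longlongrightarrow> 0) (at_left 1)"
    by simp
qed

lemma moment_tendsto:
  assumes \<phi>: "continuous_on (ball 0 1) \<phi>" "\<And>z. norm z < 1 \<Longrightarrow> norm (\<phi> z) \<le> B" and "k \<le> j"
    and "((\<lambda>r. circle_mean (\<lambda>z. \<phi> z * f z ^ (j - k)) r) \<longlongrightarrow> l) (at_left 1)"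
  shows "((\<lambda>r. circle_mean (\<lambda>z. \<phi> z * (f z ^ j * cnj (f z ^ k))) r) \<longlongrightarrow> l) (at_left 1)"
  using tendsto_add[OF moment_reduce[OF \<phi> \<open>k \<le> j\<close>] assms(4)] by simp

text \<open>This is preservation of the circle measure by \<open>f\<close>, tested on trigonometric
  monomials. For \<open>k \<le> j\<close> the mean reduces to that of the holomorphic function
  \<open>f z ^ (j - k)\<close>, hence to its value at the origin, where \<open>f\<close> vanishes;
  conjugation gives the other case.\<close>

lemma moment_power:
  "((\<lambda>r. circle_mean (\<lambda>z. f z ^ j * cnj (f z ^ k)) r) \<longlongrightarrow> (if j = k then 1 else 0)) (at_left 1)"
proof -
  have ge: "((\<lambda>r. circle_mean (\<lambda>z. 1 * (f z ^ j * cnj (f z ^ k))) r) \<longlongrightarrow> (if j = k then 1 else 0)) (at_left 1)"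
    if "k \<le> j" for j k
  proof (rule moment_tendsto[OF _ _ that, where B=1])
    have "circle_mean (\<lambda>z. 1 * f z ^ (j - k)) r = (if j = k then 1 else 0)" if "0 \<le> r" "r < 1" for r
      using that \<open>k \<le> j\<close> by (subst holomorphic_mean_value) (auto intro!: holomorphic_intros holf simp: f_0)
    then show "((\<lambda>r. circle_mean (\<lambda>z. 1 * f z ^ (j - k)) r) \<longlongrightarrow> (if j = k then 1 else 0)) (at_left 1)"
      by (intro tendsto_eventually eventually_at_left_1)
  qed auto
  show ?thesis
  proof (cases "k \<le> j")
    case True
    then show ?thesis using ge[of k j] by simp
  next
    case False
    have "((\<lambda>r. cnj (circle_mean (\<lambda>z. f z ^ k * cnj (f z ^ j)) r)) \<longlongrightarrow> cnj 0) (at_left 1)"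
      by (intro tendsto_intros) (use ge[of j k] False in simp)
    moreover have "cnj (circle_mean (\<lambda>z. f z ^ k * cnj (f z ^ j)) r)
        = circle_mean (\<lambda>z. f z ^ j * cnj (f z ^ k)) r" for r
      by (simp add: mult.commute flip: circle_mean_cnj)
    ultimately show ?thesis using False by simp
  qed
qed

section \<open>The martingale difference and its moments\<close>

definition martingale_diff :: "complex \<Rightarrow> complex" where
  "martingale_diff z = z - cnj (deriv f 0) * f z"

lemma continuous_martingale_diff: "continuous_on (ball 0 1) martingale_diff"
  unfolding martingale_diff_def by (intro continuous_intros contf)

lemma holomorphic_martingale_diff: "martingale_diff holomorphic_on ball 0 1"
  unfolding martingale_diff_def by (intro holomorphic_intros holf)

lemma norm_deriv_le_1: "norm (deriv f 0) \<le> 1"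
  using Schwarz_Lemma(2)[OF holf f_0 f_lt_1, of 0] by simp

text \<open>The bound is linear in \<open>norm z\<close>, so the terms of a martingale series
  inherit the geometric decay of the iterates.\<close>

lemma norm_martingale_diff_le: "norm z < 1 \<Longrightarrow> norm (martingale_diff z) \<le> 2 * norm z"
proof -
  assume z: "norm z < 1"
  have "norm (martingale_diff z) \<le> norm z + norm (deriv f 0) * norm (f z)"
    unfolding martingale_diff_def using norm_triangle_ineq4 norm_mult complex_mod_cnj by metis
  also have "\<dots> \<le> norm z + 1 * norm z"
    using norm_f_le[OF z] norm_deriv_le_1 by (intro add_mono mult_mono) auto
  finally show ?thesis by simp
qed

lemma norm_martingale_diff: "norm z < 1 \<Longrightarrow> norm (martingale_diff z) \<le> 2"
  using norm_martingale_diff_le[of z] by linarith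

text \<open>For \<open>k \<le> j\<close> a holomorphic function vanishing at 0 is averaged.
  Otherwise conjugation leaves the mean of \<open>cnj z * f z ^ (k - j)\<close>, which tends to the
  linear Taylor coefficient of \<open>f ^ (k - j)\<close>: this is f'(0) for exponent 1, while
  higher powers have at least a double zero at the origin.\<close>

lemma moment_id:
  "((\<lambda>r. circle_mean (\<lambda>z. z * (f z ^ j * cnj (f z ^ k))) r) \<longlongrightarrow>
      (if k = Suc j then cnj (deriv f 0) else 0)) (at_left 1)"
proof (cases "k \<le> j")
  case True
  have "((\<lambda>r. circle_mean (\<lambda>z. z * (f z ^ j * cnj (f z ^ k))) r) \<longlongrightarrow> 0) (at_left 1)"
  proof (rule moment_tendsto[OF _ _ True, where B=1])
    have "circle_mean (\<lambda>z. z * f z ^ (j - k)) r = 0" if "0 \<le> r" "r < 1" for r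
      using that by (subst holomorphic_mean_value) (auto intro!: holomorphic_intros holf)
    then show "((\<lambda>r. circle_mean (\<lambda>z. z * f z ^ (j - k)) r) \<longlongrightarrow> 0) (at_left 1)"
      by (intro tendsto_eventually eventually_at_left_1)
  qed (auto intro!: continuous_intros)
  with True show ?thesis by simp
next
  case False
  define m where "m = k - j"
  have m: "m \<ge> 1" using False by (simp add: m_def)
  have hol: "(\<lambda>z. f z ^ m) holomorphic_on ball 0 1"
    by (intro holomorphic_intros holf)
  have "(f has_field_derivative deriv f 0) (at 0)"
    by (rule holomorphic_derivI[OF holf]) auto
  then have "((\<lambda>z. f z ^ m) has_field_derivative of_nat m * (deriv f 0 * f 0 ^ (m - Suc 0))) (at 0)"
    by (rule DERIV_power)
  then have der: "deriv (\<lambda>z. f z ^ m) 0 = (if m = 1 then deriv f 0 else 0)"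
    using m by (auto simp: f_0 DERIV_imp_deriv)
  obtain c where c: "taylor c (\<lambda>z. f z ^ m)" "c 1 = deriv (\<lambda>z. f z ^ m) 0"
    using holomorphic_imp_taylor[OF hol] by metis
  have "((\<lambda>r. circle_mean (\<lambda>z. cnj z * (f z ^ k * cnj (f z ^ j))) r) \<longlongrightarrow> c 1) (at_left 1)"
  proof (rule moment_tendsto[where B=1])
    have A: "((\<lambda>r. c 1 * complex_of_real (r\<^sup>2)) \<longlongrightarrow> c 1 * complex_of_real (1\<^sup>2)) (at_left 1)"
      by (intro tendsto_intros)
    have B: "c 1 * of_real (r\<^sup>2) = circle_mean (\<lambda>z. cnj z * f z ^ (k - j)) r"
      if "0 \<le> r" "r < 1" for r
      using circle_mean_mult_cnj[OF c(1) that] by (simp add: m_def mult.commute)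
    show "((\<lambda>r. circle_mean (\<lambda>z. cnj z * f z ^ (k - j)) r) \<longlongrightarrow> c 1) (at_left 1)"
      using tendsto_at_left_1_cong[OF A B] by simp
  qed (use False in \<open>auto intro!: continuous_intros\<close>)
  then have "((\<lambda>r. cnj (circle_mean (\<lambda>z. cnj z * (f z ^ k * cnj (f z ^ j))) r)) \<longlongrightarrow> cnj (c 1)) (at_left 1)"
    by (intro tendsto_intros)
  moreover have "cnj (circle_mean (\<lambda>z. cnj z * (f z ^ k * cnj (f z ^ j))) r)
      = circle_mean (\<lambda>z. z * (f z ^ j * cnj (f z ^ k))) r" for r
    by (simp add: mult_ac flip: circle_mean_cnj)
  moreover have "m = 1 \<longleftrightarrow> k = Suc j"
    using False by (auto simp: m_def)
  ultimately show ?thesis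
    using der c(2) by auto
qed

text \<open>The correction \<open>cnj (deriv f 0) * f z\<close> raises the exponent \<open>j\<close>
  by one, so by \<open>moment_power\<close> it contributes exactly when \<open>k = Suc j\<close> and
  cancels the only nonzero case of \<open>moment_id\<close>. This is the vanishing conditional
  expectation given \<open>f\<close>, tested on monomials.\<close>

lemma moment_martingale_diff:
  "((\<lambda>r. circle_mean (\<lambda>z. martingale_diff z * (f z ^ j * cnj (f z ^ k))) r) \<longlongrightarrow> 0) (at_left 1)"
proof -
  have A: "((\<lambda>r. circle_mean (\<lambda>z. z * (f z ^ j * cnj (f z ^ k))) r
           - cnj (deriv f 0) * circle_mean (\<lambda>z. f z ^ Suc j * cnj (f z ^ k)) r)
      \<longlongrightarrow> (if k = Suc j then cnj (deriv f 0) else 0) - cnj (deriv f 0) * (if Suc j = k then 1 else 0))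
      (at_left 1)"
    by (intro tendsto_intros moment_id moment_power)
  have B: "circle_mean (\<lambda>z. z * (f z ^ j * cnj (f z ^ k))) r
           - cnj (deriv f 0) * circle_mean (\<lambda>z. f z ^ Suc j * cnj (f z ^ k)) r
      = circle_mean (\<lambda>z. martingale_diff z * (f z ^ j * cnj (f z ^ k))) r" if "0 \<le> r" "r < 1" for r
    unfolding circle_mean_mult_left[symmetric]
    by (subst circle_mean_diff[symmetric])
       (auto intro!: continuous_intros contf that simp: martingale_diff_def algebra_simps)
  show ?thesis
    using tendsto_at_left_1_cong[OF A B] by (cases "k = Suc j") auto
qed

text \<open>Write |d|^2 as \<open>d * cnj z - a * d * cnj (f z)\<close>. The first term yields the
  linear coefficient 1 - |a|^2 of d, and the second vanishes in the limit by orthogonality.\<close>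

lemma square_mean_martingale_diff:
  "((\<lambda>r. circle_mean (\<lambda>z. (norm (martingale_diff z))\<^sup>2) r) \<longlongrightarrow> 1 - (norm (deriv f 0))\<^sup>2) (at_left 1)"
proof -
  define a where "a = deriv f 0"
  obtain c where c: "taylor c martingale_diff" "c 1 = deriv martingale_diff 0"
    using holomorphic_imp_taylor[OF holomorphic_martingale_diff] by metis
  have "(f has_field_derivative a) (at 0)"
    unfolding a_def by (rule holomorphic_derivI[OF holf]) auto
  then have "(martingale_diff has_field_derivative 1 - cnj a * a) (at 0)"
    unfolding martingale_diff_def[abs_def] a_def[symmetric] by (auto intro!: derivative_eq_intros)
  then have c1: "c 1 = 1 - cnj a * a"
    using c(2) by (simp add: DERIV_imp_deriv)
  have A: "((\<lambda>r. c 1 * complex_of_real (r\<^sup>2)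
           - a * circle_mean (\<lambda>z. martingale_diff z * (f z ^ 0 * cnj (f z ^ 1))) r)
       \<longlongrightarrow> c 1 * complex_of_real (1\<^sup>2) - a * 0) (at_left 1)"
    by (intro tendsto_intros moment_martingale_diff)
  have B: "c 1 * complex_of_real (r\<^sup>2)
           - a * circle_mean (\<lambda>z. martingale_diff z * (f z ^ 0 * cnj (f z ^ 1))) r
       = of_real (circle_mean (\<lambda>z. (norm (martingale_diff z))\<^sup>2) r)" if "0 \<le> r" "r < 1" for r
    unfolding circle_mean_mult_cnj[OF c(1) that, symmetric] circle_mean_mult_left[symmetric]
      circle_mean_of_real[symmetric] complex_norm_square
    by (subst circle_mean_diff[symmetric])
       (auto intro!: continuous_intros contf that continuous_martingale_diff
         simp: martingale_diff_def a_def algebra_simps)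
  have "((\<lambda>r. of_real (circle_mean (\<lambda>z. (norm (martingale_diff z))\<^sup>2) r)) \<longlongrightarrow> c 1) (at_left 1)"
    using tendsto_at_left_1_cong[OF A B] by simp
  moreover have "c 1 = of_real (1 - (norm a)\<^sup>2)"
    unfolding c1 using complex_norm_square[of a] by (simp add: mult.commute)
  ultimately show ?thesis
    unfolding a_def[symmetric] by (simp only: tendsto_of_real_iff)
qed

section \<open>Weighted square means of functions of \<open>f\<close>\<close>

text \<open>Expanding the square leaves only the diagonal. The weight is kept general for two cases:
  weight 1 with \<open>l = 1\<close> gives isometry, and the martingale difference with
  \<open>l = 0\<close> gives orthogonality to squared moduli.\<close>

lemma weighted_square_mean_polynomial:
  assumes \<phi>: "continuous_on (ball 0 1) \<phi>"
    and moments: "\<And>j k. ((\<lambda>r. circle_mean (\<lambda>z. \<phi> z * (f z ^ j * cnj (f z ^ k))) r)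
           \<longlongrightarrow> (if j = k then l else 0)) (at_left 1)"
  shows "((\<lambda>r. circle_mean (\<lambda>z. \<phi> z * of_real ((norm (\<Sum>n<N. c n * f z ^ n))\<^sup>2)) r)
           \<longlongrightarrow> l * of_real (\<Sum>n<N. (norm (c n))\<^sup>2)) (at_left 1)"
proof -
  have "((\<lambda>r. \<Sum>j<N. \<Sum>k<N. c j * cnj (c k) * circle_mean (\<lambda>z. \<phi> z * (f z ^ j * cnj (f z ^ k))) r)
      \<longlongrightarrow> (\<Sum>j<N. \<Sum>k<N. c j * cnj (c k) * (if j = k then l else 0))) (at_left 1)"
    by (intro tendsto_intros moments)
  moreover have "(\<Sum>j<N. \<Sum>k<N. c j * cnj (c k) * circle_mean (\<lambda>z. \<phi> z * (f z ^ j * cnj (f z ^ k))) r)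
      = circle_mean (\<lambda>z. \<phi> z * of_real ((norm (\<Sum>n<N. c n * f z ^ n))\<^sup>2)) r"
    if r: "0 \<le> r" "r < 1" for r
  proof -
    have "\<phi> z * of_real ((norm (\<Sum>n<N. c n * f z ^ n))\<^sup>2)
        = (\<Sum>j<N. \<Sum>k<N. c j * cnj (c k) * (\<phi> z * (f z ^ j * cnj (f z ^ k))))" for z
    proof -
      have "complex_of_real ((norm (\<Sum>n<N. c n * f z ^ n))\<^sup>2)
          = (\<Sum>j<N. \<Sum>k<N. (c j * f z ^ j) * cnj (c k * f z ^ k))"
        unfolding complex_norm_square cnj_sum by (rule sum_product)
      then show ?thesis
        by (simp only: sum_distrib_left) (intro sum.cong refl, simp add: mult_ac)
    qed
    then show ?thesis
      by (simp add: circle_mean_sum r continuous_intros \<phi> contf del: circle_mean_mult_left complex_cnj_power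
            flip: circle_mean_mult_left)
  qed
  ultimately have "((\<lambda>r. circle_mean (\<lambda>z. \<phi> z * of_real ((norm (\<Sum>n<N. c n * f z ^ n))\<^sup>2)) r)
      \<longlongrightarrow> (\<Sum>j<N. \<Sum>k<N. c j * cnj (c k) * (if j = k then l else 0))) (at_left 1)"
    by (rule tendsto_at_left_1_cong)
  moreover have "(\<Sum>j<N. \<Sum>k<N. c j * cnj (c k) * (if j = k then l else 0))
      = l * of_real (\<Sum>n<N. (norm (c n))\<^sup>2)"
    unfolding of_real_sum complex_norm_square by (simp add: sum_distrib_left if_distrib mult_ac cong: if_cong)
  ultimately show ?thesis by simp
qed

text \<open>Littlewood subordination in exponent 2. For polynomials the mean at radius
  \<open>r\<close> is below its limit at radius 1, which is computed from the moments; the general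
  case follows by dominated convergence on the circle of radius \<open>r\<close>. The bound is
  uniform in \<open>r\<close>, which later permits truncation before the radius tends to 1.\<close>

lemma square_mean_compose_le:
  assumes c: "taylor c g" "summable (\<lambda>n. (norm (c n))\<^sup>2)" and r: "0 \<le> r" "r < 1"
  shows "circle_mean (\<lambda>z. (norm (g (f z)))\<^sup>2) r \<le> (\<Sum>n. (norm (c n))\<^sup>2)"
proof -
  define P where "P N z = (\<Sum>n<N. c n * f z ^ n)" for N z
  define S where "S = (\<Sum>n. (norm (c n))\<^sup>2)"
  have holP: "P N holomorphic_on ball 0 1" for N
    unfolding P_def by (intro holomorphic_intros holf)
  have le: "circle_mean (\<lambda>z. (norm (P N z))\<^sup>2) r \<le> S" for N
  proof -
    have "((\<lambda>s. circle_mean (\<lambda>z. 1 * complex_of_real ((norm (P N z))\<^sup>2)) s)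
             \<longlongrightarrow> 1 * of_real (\<Sum>n<N. (norm (c n))\<^sup>2)) (at_left 1)"
      unfolding P_def by (rule weighted_square_mean_polynomial) (use moment_power in simp_all)
    then have "((\<lambda>s. circle_mean (\<lambda>z. (norm (P N z))\<^sup>2) s) \<longlongrightarrow> (\<Sum>n<N. (norm (c n))\<^sup>2)) (at_left 1)"
      unfolding mult_1 circle_mean_of_real tendsto_of_real_iff .
    moreover have "\<forall>\<^sub>F s in at_left 1. circle_mean (\<lambda>z. (norm (P N z))\<^sup>2) r \<le> circle_mean (\<lambda>z. (norm (P N z))\<^sup>2) s"
      by (rule eventually_at_leftI[of r]) (use r in \<open>auto intro!: square_mean_mono holP\<close>)
    ultimately have "circle_mean (\<lambda>z. (norm (P N z))\<^sup>2) r \<le> (\<Sum>n<N. (norm (c n))\<^sup>2)"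
      by (rule tendsto_lowerbound) simp
    also have "\<dots> \<le> S"
      unfolding S_def by (intro sum_le_suminf c(2)) auto
    finally show ?thesis .
  qed
  define K where "K = (\<Sum>n. norm (c n) * r ^ n)"
  have abs: "summable (\<lambda>n. norm (c n) * r ^ n)"
    by (rule taylor_abs_summable[OF c(1) r])
  have "(\<lambda>N. circle_mean (\<lambda>z. (norm (P N z))\<^sup>2) r) \<longlonglongrightarrow> circle_mean (\<lambda>z. (norm (g (f z)))\<^sup>2) r"
  proof (rule circle_mean_tendsto[OF _ _ r])
    show "continuous_on (ball 0 1) (\<lambda>z. (norm (P n z))\<^sup>2)" for n
      by (intro continuous_intros holomorphic_on_imp_continuous_on[OF holP])
    show "continuous_on (ball 0 1) (\<lambda>z. (norm (g (f z)))\<^sup>2)"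
      by (intro continuous_intros continuous_compose holomorphic_on_imp_continuous_on
            taylor_holomorphic[OF c(1)])
    fix z :: complex assume z: "norm z = r"
    then have "(\<lambda>n. c n * f z ^ n) sums g (f z)"
      using c(1) f_lt_1[of z] r by (simp add: taylor_def)
    then show "(\<lambda>n. (norm (P n z))\<^sup>2) \<longlonglongrightarrow> (norm (g (f z)))\<^sup>2"
      unfolding P_def sums_def by (intro tendsto_intros)
    fix n
    have "norm (P n z) \<le> (\<Sum>k<n. norm (c k) * r ^ k)"
      unfolding P_def
      using norm_f_le[of z] z r
      by (intro sum_norm_le) (auto simp: norm_mult norm_power intro!: mult_left_mono power_mono)
    also have "\<dots> \<le> K"
      unfolding K_def by (intro sum_le_suminf abs) (use r in auto)
    finally show "norm ((norm (P n z))\<^sup>2) \<le> K\<^sup>2"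
      by (simp add: power_mono)
  qed
  then show ?thesis
    using le unfolding S_def by (intro LIMSEQ_le_const2) auto
qed

text \<open>\<open>h\<close> is replaced by a Taylor polynomial, with an error uniform in the radius
  because \<open>square_mean_compose_le\<close> applies to \<open>h\<close> and to its tail; only
  then does the radius tend to 1.\<close>

lemma weighted_square_mean_tendsto:
  assumes \<phi>: "continuous_on (ball 0 1) \<phi>" "\<And>z. norm z < 1 \<Longrightarrow> norm (\<phi> z) \<le> B"
    and moments: "\<And>j k. ((\<lambda>r. circle_mean (\<lambda>z. \<phi> z * (f z ^ j * cnj (f z ^ k))) r)
           \<longlongrightarrow> (if j = k then l else 0)) (at_left 1)"
    and c: "taylor c h" "summable (\<lambda>n. (norm (c n))\<^sup>2)"
  shows "((\<lambda>r. circle_mean (\<lambda>z. \<phi> z * of_real ((norm (h (f z)))\<^sup>2)) r)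
           \<longlongrightarrow> l * of_real (\<Sum>n. (norm (c n))\<^sup>2)) (at_left 1)"
proof (rule tendstoI)
  fix e :: real assume "0 < e"
  define S where "S = (\<Sum>n. (norm (c n))\<^sup>2)"
  define s where "s N = (\<Sum>n<N. (norm (c n))\<^sup>2)" for N
  have S0: "0 \<le> S"
    unfolding S_def by (intro suminf_nonneg c(2)) auto
  have B0: "0 \<le> B"
    using order_trans[OF norm_ge_zero \<phi>(2)[of 0]] by simp
  \<comment> \<open>Chosen so that \<open>B * (\<epsilon> * S)\<close> is at most
    \<open>e / 8\<close>; the added 1 keeps the denominator positive when
    \<open>B * S = 0\<close>.\<close>
  define \<epsilon> where "\<epsilon> = e / (8 * (B * S + 1))"
  have \<epsilon>: "0 < \<epsilon>" and \<epsilon>': "B * (\<epsilon> * S) \<le> e / 8"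
  proof -
    have pos: "0 < B * S + 1" using B0 S0 by (simp add: add_nonneg_pos)
    then show "0 < \<epsilon>" using \<open>0 < e\<close> by (simp add: \<epsilon>_def)
    have "B * (\<epsilon> * S) = e / 8 * (B * S / (B * S + 1))"
      using pos by (simp add: \<epsilon>_def field_simps)
    also have "\<dots> \<le> e / 8 * 1"
      using pos \<open>0 < e\<close> by (intro mult_left_mono) (auto simp: divide_le_eq)
    finally show "B * (\<epsilon> * S) \<le> e / 8" by simp
  qed
  have "s \<longlonglongrightarrow> S"
    using summable_LIMSEQ[OF c(2)] unfolding s_def[abs_def] S_def .
  then have lim: "(\<lambda>N. B * ((1 + 1 / \<epsilon>) * (S - s N)) + norm l * (S - s N)) \<longlonglongrightarrow>
      B * ((1 + 1 / \<epsilon>) * (S - S)) + norm l * (S - S)"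
    by (intro tendsto_intros)
  have "\<forall>\<^sub>F N in sequentially. B * ((1 + 1 / \<epsilon>) * (S - s N)) + norm l * (S - s N) < e / 8"
    by (rule order_tendstoD(2)[OF lim]) (use \<open>0 < e\<close> in simp)
  \<comment> \<open>One \<open>N\<close> serves both the truncation error under the mean and the
    missing part of the limit. The final count is e/4 + e/4 + e/8.\<close>
  then obtain N where N: "B * ((1 + 1 / \<epsilon>) * (S - s N)) + norm l * (S - s N) < e / 8"
    by (auto simp: eventually_sequentially)
  have sS: "s N \<le> S"
    unfolding s_def S_def by (intro sum_le_suminf c(2)) auto
  define P where "P z = (\<Sum>n<N. c n * z ^ n)" for z
  have holh: "h holomorphic_on ball 0 1"
    by (rule taylor_holomorphic[OF c(1)])
  have contP: "continuous_on A (\<lambda>z. P (f z))" if "continuous_on A f" for A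
    unfolding P_def by (intro continuous_intros that)
  have conth: "continuous_on (ball 0 1) (\<lambda>z. h (f z))"
    by (intro continuous_compose holomorphic_on_imp_continuous_on holh)
  have close: "norm (circle_mean (\<lambda>z. \<phi> z * of_real ((norm (h (f z)))\<^sup>2)) r
        - circle_mean (\<lambda>z. \<phi> z * of_real ((norm (P (f z)))\<^sup>2)) r) \<le> e / 4"
    if r: "0 \<le> r" "r < 1" for r
  proof -
    have "norm (circle_mean (\<lambda>z. \<phi> z * of_real ((norm (h (f z)))\<^sup>2)
          - \<phi> z * of_real ((norm (P (f z)))\<^sup>2)) r)
        \<le> circle_mean (\<lambda>z. B * (\<epsilon> * (norm (h (f z)))\<^sup>2
            + (1 + 1 / \<epsilon>) * (norm (h (f z) - P (f z)))\<^sup>2)) r"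
    proof (rule norm_circle_mean_le[OF _ _ r])
      fix z :: complex assume z: "norm z < 1"
      have "norm (\<phi> z * of_real ((norm (h (f z)))\<^sup>2) - \<phi> z * of_real ((norm (P (f z)))\<^sup>2))
          = norm (\<phi> z) * \<bar>(norm (h (f z)))\<^sup>2 - (norm (P (f z)))\<^sup>2\<bar>"
        by (simp only: right_diff_distrib[symmetric] of_real_diff[symmetric] norm_mult norm_of_real)
      also have "\<dots> \<le> B * (\<epsilon> * (norm (h (f z)))\<^sup>2 + (1 + 1 / \<epsilon>) * (norm (h (f z) - P (f z)))\<^sup>2)"
        using \<phi>(2)[OF z] B0 by (intro mult_mono abs_square_diff_le \<epsilon>) auto
      finally show "norm (\<phi> z * of_real ((norm (h (f z)))\<^sup>2) - \<phi> z * of_real ((norm (P (f z)))\<^sup>2))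
          \<le> B * (\<epsilon> * (norm (h (f z)))\<^sup>2 + (1 + 1 / \<epsilon>) * (norm (h (f z) - P (f z)))\<^sup>2)" .
    qed (intro continuous_intros \<phi>(1) conth contP contf)+
    also have "\<dots> = B * (\<epsilon> * circle_mean (\<lambda>z. (norm (h (f z)))\<^sup>2) r
            + (1 + 1 / \<epsilon>) * circle_mean (\<lambda>z. (norm (h (f z) - P (f z)))\<^sup>2) r)"
      by (subst circle_mean_mult_left, subst circle_mean_add)
         (intro continuous_intros conth contP contf r | simp)+
    also have "\<dots> \<le> B * (\<epsilon> * S + (1 + 1 / \<epsilon>) * (S - s N))"
    proof (intro mult_left_mono add_mono B0)
      show "circle_mean (\<lambda>z. (norm (h (f z)))\<^sup>2) r \<le> S"
        unfolding S_def by (rule square_mean_compose_le[OF c r])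
      have "circle_mean (\<lambda>z. (norm (h (f z) - P (f z)))\<^sup>2) r
          \<le> (\<Sum>n. (norm (if n < N then 0 else c n))\<^sup>2)"
        using square_mean_compose_le[OF taylor_tail[OF c(1)] sums_summable[OF tail_square_sums[OF c(2)]] r]
        unfolding P_def .
      also have "\<dots> = S - s N"
        using sums_unique[OF tail_square_sums[OF c(2)]] unfolding S_def s_def by simp
      finally show "circle_mean (\<lambda>z. (norm (h (f z) - P (f z)))\<^sup>2) r \<le> S - s N" .
    qed (use \<epsilon> in auto)
    also have "\<dots> \<le> e / 8 + e / 8"
    proof -
      have "0 \<le> norm l * (S - s N)" using sS by simp
      then show ?thesis using N \<epsilon>' unfolding distrib_left[of B] by linarith
    qed
    finally show ?thesis
      by (subst (asm) circle_mean_diff) (intro continuous_intros \<phi>(1) conth contP contf r | simp)+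
  qed
  have "norm (l * of_real (s N) - l * of_real S) = norm l * (S - s N)"
    using sS by (simp add: norm_mult flip: right_diff_distrib of_real_diff)
  also have "\<dots> < e / 8"
  proof -
    have "0 \<le> B * ((1 + 1 / \<epsilon>) * (S - s N))" using sS B0 \<epsilon> by simp
    then show ?thesis using N by linarith
  qed
  finally have close': "norm (l * of_real (s N) - l * of_real S) < e / 8" .
  have "((\<lambda>r. circle_mean (\<lambda>z. \<phi> z * of_real ((norm (P (f z)))\<^sup>2)) r) \<longlongrightarrow> l * of_real (s N)) (at_left 1)"
    unfolding P_def s_def by (rule weighted_square_mean_polynomial[OF \<phi>(1) moments])
  then have "\<forall>\<^sub>F r in at_left 1.
      dist (circle_mean (\<lambda>z. \<phi> z * of_real ((norm (P (f z)))\<^sup>2)) r) (l * of_real (s N)) < e / 4"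
    by (rule tendstoD) (use \<open>0 < e\<close> in simp)
  moreover have "\<forall>\<^sub>F r in at_left 1. dist (circle_mean (\<lambda>z. \<phi> z * of_real ((norm (h (f z)))\<^sup>2)) r)
      (circle_mean (\<lambda>z. \<phi> z * of_real ((norm (P (f z)))\<^sup>2)) r) \<le> e / 4"
    unfolding dist_norm by (rule eventually_at_left_1[OF close])
  ultimately show "\<forall>\<^sub>F r in at_left 1.
      dist (circle_mean (\<lambda>z. \<phi> z * of_real ((norm (h (f z)))\<^sup>2)) r) (l * of_real (\<Sum>n. (norm (c n))\<^sup>2)) < e"
  proof eventually_elim
    case (elim r)
    have "dist A D \<le> dist A B + dist B C + dist C D" for A B C D :: complex
      using dist_triangle[of A D B] dist_triangle[of B D C] by simp
    from this[of "circle_mean (\<lambda>z. \<phi> z * of_real ((norm (h (f z)))\<^sup>2)) r" "l * of_real S"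
        "circle_mean (\<lambda>z. \<phi> z * of_real ((norm (P (f z)))\<^sup>2)) r" "l * of_real (s N)"]
    show ?case
      using elim close' \<open>0 < e\<close> unfolding S_def[symmetric] dist_norm by linarith
  qed
qed

text \<open>Polarisation: the quadratic statement applied to \<open>h + 1\<close> and to \<open>h\<close> differs by \<open>h + cnj h + 1\<close>,
  and the holomorphic part \<open>h + 1\<close> contributes its value 0 at the origin.\<close>

lemma cross_mean_tendsto:
  assumes c: "taylor c h" "summable (\<lambda>n. (norm (c n))\<^sup>2)"
  shows "((\<lambda>r. circle_mean (\<lambda>z. martingale_diff z * cnj (h (f z))) r) \<longlongrightarrow> 0) (at_left 1)"
proof -
  define d where "d = martingale_diff"
  define T where "T h r = circle_mean (\<lambda>z. d z * of_real ((norm (h (f z)))\<^sup>2)) r"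
    for h :: "complex \<Rightarrow> complex" and r
  have T: "(T h \<longlongrightarrow> 0) (at_left 1)" if "taylor c h" "summable (\<lambda>n. (norm (c n))\<^sup>2)" for c h
    using weighted_square_mean_tendsto[OF continuous_martingale_diff norm_martingale_diff _ that, of 0]
      moment_martingale_diff unfolding T_def[abs_def] d_def by simp
  define c' where "c' = c(0 := c 0 + 1)"
  have "taylor c' (\<lambda>z. h z + 1)"
    unfolding taylor_def
  proof (intro allI impI)
    fix z :: complex assume "norm z < 1"
    then have "(\<lambda>n. c n * z ^ n + (if n = 0 then 1 else 0)) sums (h z + 1)"
      using c(1) sums_single[of 0 "\<lambda>_. 1::complex"] by (intro sums_add) (auto simp: taylor_def)
    moreover have "(\<lambda>n. c n * z ^ n + (if n = 0 then 1 else 0)) = (\<lambda>n. c' n * z ^ n)"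
      by (auto simp: c'_def)
    ultimately show "(\<lambda>n. c' n * z ^ n) sums (h z + 1)" by simp
  qed
  moreover have "summable (\<lambda>n. (norm (c' n))\<^sup>2)"
  proof -
    have "\<forall>\<^sub>F n in sequentially. (norm (c n))\<^sup>2 = (norm (c' n))\<^sup>2"
      unfolding eventually_sequentially by (rule exI[of _ 1]) (auto simp: c'_def)
    from summable_cong[OF this] show ?thesis using c(2) by simp
  qed
  ultimately have "((\<lambda>r. T (\<lambda>z. h z + 1) r - T h r) \<longlongrightarrow> 0 - 0) (at_left 1)"
    using T[OF c] by (intro tendsto_diff) (rule T)
  moreover have "T (\<lambda>z. h z + 1) r - T h r = circle_mean (\<lambda>z. d z * cnj (h (f z))) r"
    if r: "0 \<le> r" "r < 1" for r
  proof -
    have hol: "(\<lambda>z. h (f z)) holomorphic_on ball 0 1"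
      by (rule holomorphic_compose[OF taylor_holomorphic[OF c(1)]])
    note cont = holomorphic_on_imp_continuous_on[OF hol] continuous_martingale_diff[folded d_def]
    have "T (\<lambda>z. h z + 1) r - T h r
        = circle_mean (\<lambda>z. d z * cnj (h (f z)) + d z * (h (f z) + 1)) r"
      unfolding T_def complex_norm_square
      by (subst circle_mean_diff[symmetric], (intro continuous_intros cont r)+)
         (simp add: algebra_simps)
    also have "\<dots> = circle_mean (\<lambda>z. d z * cnj (h (f z))) r + circle_mean (\<lambda>z. d z * (h (f z) + 1)) r"
      by (intro circle_mean_add continuous_intros cont r)
    also have "circle_mean (\<lambda>z. d z * (h (f z) + 1)) r = d 0 * (h (f 0) + 1)"
      unfolding d_def
      by (intro holomorphic_mean_value holomorphic_intros holomorphic_martingale_diff hol r)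
    also have "d 0 = 0"
      by (simp add: d_def martingale_diff_def f_0)
    finally show ?thesis by simp
  qed
  ultimately have "((\<lambda>r. circle_mean (\<lambda>z. d z * cnj (h (f z))) r) \<longlongrightarrow> 0 - 0) (at_left 1)"
    by (rule tendsto_at_left_1_cong)
  then show ?thesis by (simp add: d_def)
qed

end

section \<open>Exponential moments of the martingale\<close>

context inner_fixing_origin
begin

lemma iterate_lt_1: "norm z < 1 \<Longrightarrow> norm ((f ^^ n) z) < 1"
  by (induction n) (auto intro: f_lt_1)

lemma holomorphic_iterate: "(f ^^ n) holomorphic_on ball 0 1"
proof (induction n)
  case 0
  then show ?case by (simp add: id_def)
next
  case (Suc n)
  from holomorphic_compose[OF this] show ?case
    by (simp add: funpow_swap1 o_def del: funpow.simps add: funpow_Suc_right)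
qed

definition martingale_sum :: "(nat \<Rightarrow> complex) \<Rightarrow> nat \<Rightarrow> complex \<Rightarrow> complex" where
  "martingale_sum \<beta> N z = (\<Sum>n<N. \<beta> n * martingale_diff ((f ^^ n) z))"

text \<open>Everything after the first term is a function of \<open>f z\<close>, so averaging
  against functions of \<open>f\<close> isolates that term. The inductive estimate of exponential
  means rests on this self-similarity.\<close>

lemma martingale_sum_Suc:
  "martingale_sum \<beta> (Suc N) z = \<beta> 0 * martingale_diff z + martingale_sum (\<lambda>n. \<beta> (Suc n)) N (f z)"
  unfolding martingale_sum_def sum.lessThan_Suc_shift by (simp add: funpow_swap1)

lemma holomorphic_martingale_diff_iterate:
  "(\<lambda>z. martingale_diff ((f ^^ n) z)) holomorphic_on ball 0 1"
  using holomorphic_on_compose_gen[OF holomorphic_iterate holomorphic_martingale_diff] iterate_lt_1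
  by (force simp: o_def)

lemma holomorphic_martingale_sum: "martingale_sum \<beta> N holomorphic_on ball 0 1"
  unfolding martingale_sum_def by (intro holomorphic_intros holomorphic_martingale_diff_iterate)

text \<open>One Azuma step. The exponential is replaced by its quadratic bound; against the weight
  |h(f)|^2 the linear term averages to 0 in the limit, and the quadratic term costs the factor
  \<open>1 + 4 * (norm b)\<^sup>2\<close>.\<close>

lemma exp_mean_step:
  assumes b: "norm b \<le> 1 / 2"
    and c: "taylor c h" "summable (\<lambda>n. (norm (c n))\<^sup>2)" and r: "0 \<le> r" "r < 1"
  shows "circle_mean (\<lambda>z. exp (Re (b * martingale_diff z)) * (norm (h (f z)))\<^sup>2) r
     \<le> (1 + 4 * (norm b)\<^sup>2) * (\<Sum>n. (norm (c n))\<^sup>2)"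
proof -
  define d where "d = martingale_diff"
  define S where "S = (\<Sum>n. (norm (c n))\<^sup>2)"
  \<comment> \<open>Since |d| is at most 2, the exponent \<open>x\<close> satisfies |x| at most
    \<open>2 * norm b\<close>, whose square is the 4 here; \<open>norm b \<le> 1 / 2\<close> keeps
    |x| at most 1.\<close>
  define Q where "Q = 1 + 4 * (norm b)\<^sup>2"
  define G where "G z = exp (b * d z / 2) * h (f z)" for z
  have holh: "(\<lambda>z. h (f z)) holomorphic_on ball 0 1"
    by (rule holomorphic_compose[OF taylor_holomorphic[OF c(1)]])
  note cont = holomorphic_on_imp_continuous_on[OF holh] continuous_martingale_diff[folded d_def]
  have holG: "G holomorphic_on ball 0 1"
    unfolding G_def d_def by (intro holomorphic_intros holomorphic_martingale_diff holh) auto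
  have G: "(norm (G z))\<^sup>2 = exp (Re (b * d z)) * (norm (h (f z)))\<^sup>2" for z
    unfolding G_def norm_mult power_mult_distrib norm_exp_half ..
  define T where "T s = circle_mean (\<lambda>z. d z * of_real ((norm (h (f z)))\<^sup>2)) s" for s
  \<comment> \<open>The linear term \<open>T s\<close> vanishes only as \<open>s\<close> tends to 1,
    so the mean at \<open>r\<close> is first raised to a larger radius \<open>s\<close>.\<close>
  have le: "circle_mean (\<lambda>z. (norm (G z))\<^sup>2) r \<le> Q * S + Re (b * T s)" if s: "r \<le> s" "s < 1" for s
  proof -
    have s0: "0 \<le> s" using s r by simp
    have "circle_mean (\<lambda>z. (norm (G z))\<^sup>2) r \<le> circle_mean (\<lambda>z. (norm (G z))\<^sup>2) s"
      by (intro square_mean_mono holG r s)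
    also have "\<dots> \<le> circle_mean (\<lambda>z. Q * (norm (h (f z)))\<^sup>2
        + Re (b * (d z * of_real ((norm (h (f z)))\<^sup>2)))) s"
    proof (rule circle_mean_mono[OF _ _ s0 s(2)])
      fix z :: complex assume z: "norm z < 1"
      define x where "x = Re (b * d z)"
      have "\<bar>x\<bar> \<le> norm b * norm (d z)"
        unfolding x_def norm_mult[symmetric] by (rule abs_Re_le_cmod)
      also have bd: "\<dots> \<le> norm b * 2"
        unfolding d_def by (intro mult_left_mono norm_martingale_diff z) auto
      finally have x: "\<bar>x\<bar> \<le> 2 * norm b" by simp
      then have "x\<^sup>2 \<le> (2 * norm b)\<^sup>2"
        by (rule abs_le_square_iff[THEN iffD1, OF order_trans]) simp
      moreover have "exp x \<le> 1 + x + x\<^sup>2"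
        using x b by (intro exp_le_quadratic) simp
      ultimately have "exp x \<le> Q + x"
        by (simp add: Q_def power_mult_distrib)
      then have "exp x * (norm (h (f z)))\<^sup>2 \<le> (Q + x) * (norm (h (f z)))\<^sup>2"
        by (rule mult_right_mono) simp
      then show "(norm (G z))\<^sup>2 \<le> Q * (norm (h (f z)))\<^sup>2 + Re (b * (d z * of_real ((norm (h (f z)))\<^sup>2)))"
        unfolding G x_def[symmetric] mult.assoc[symmetric] Re_complex_of_real
        by (simp add: x_def algebra_simps)
    qed (intro continuous_intros cont holomorphic_on_imp_continuous_on[OF holG])+
    also have "\<dots> = Q * circle_mean (\<lambda>z. (norm (h (f z)))\<^sup>2) s + Re (b * T s)"
      unfolding T_def circle_mean_mult_left[symmetric]
      by (subst circle_mean_Re[symmetric], (intro continuous_intros cont s0 s)+,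
          rule circle_mean_add) (intro continuous_intros cont s0 s)+
    also have "\<dots> \<le> Q * S + Re (b * T s)"
      unfolding S_def Q_def by (intro add_right_mono mult_left_mono square_mean_compose_le c s s0) auto
    finally show ?thesis .
  qed
  have "(T \<longlongrightarrow> 0) (at_left 1)"
    using weighted_square_mean_tendsto[OF continuous_martingale_diff norm_martingale_diff _ c, of 0]
      moment_martingale_diff unfolding T_def d_def by simp
  then have "((\<lambda>s. Q * S + Re (b * T s)) \<longlongrightarrow> Q * S + Re (b * 0)) (at_left 1)"
    by (intro tendsto_intros)
  moreover have "\<forall>\<^sub>F s in at_left 1. circle_mean (\<lambda>z. (norm (G z))\<^sup>2) r \<le> Q * S + Re (b * T s)"
    by (rule eventually_at_leftI[of r]) (use r le in auto)
  ultimately have "circle_mean (\<lambda>z. (norm (G z))\<^sup>2) r \<le> Q * S + Re (b * 0)"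
    by (rule tendsto_lowerbound) simp
  then show ?thesis
    unfolding G by (simp add: d_def Q_def S_def)
qed

text \<open>The first coefficient is split off with \<open>exp_mean_step\<close>, the remaining sum
  being absorbed into \<open>h\<close>. The factors
  \<open>1 + 4 * (norm (\<beta> n))\<^sup>2\<close> multiply and are bounded by
  exponentials.\<close>

lemma exp_mean_martingale_sum:
  assumes "\<And>n. norm (\<beta> n) \<le> 1 / 2" and "0 \<le> r" "r < 1"
  shows "circle_mean (\<lambda>z. exp (Re (martingale_sum \<beta> N z))) r \<le> exp (4 * (\<Sum>n<N. (norm (\<beta> n))\<^sup>2))"
  using assms
proof (induction N arbitrary: \<beta> r)
  case 0
  then show ?case by (simp add: martingale_sum_def)
next
  case (Suc N)
  define \<beta>' where "\<beta>' n = \<beta> (Suc n)" for n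
  define K where "K = exp (4 * (\<Sum>n<N. (norm (\<beta>' n))\<^sup>2))"
  define h where "h z = exp (martingale_sum \<beta>' N z / 2)" for z
  have "h holomorphic_on ball 0 1"
    unfolding h_def by (intro holomorphic_intros holomorphic_martingale_sum) auto
  then obtain c where c: "taylor c h"
    using holomorphic_imp_taylor by blast
  have sq: "(norm (h z))\<^sup>2 = exp (Re (martingale_sum \<beta>' N z))" for z
    unfolding h_def norm_exp_half ..
  \<comment> \<open>All radii are needed, not just the given one: the square sum of the Taylor
    coefficients of \<open>h\<close> is bounded by the supremum of these means.\<close>
  have "circle_mean (\<lambda>z. (norm (h z))\<^sup>2) r \<le> K" if "0 \<le> r" "r < 1" for r
    unfolding sq K_def by (rule Suc.IH) (use Suc.prems that in \<open>auto simp: \<beta>'_def\<close>)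
  note S = bounded_square_mean[OF c this]
  have "circle_mean (\<lambda>z. exp (Re (martingale_sum \<beta> (Suc N) z))) r
      = circle_mean (\<lambda>z. exp (Re (\<beta> 0 * martingale_diff z)) * (norm (h (f z)))\<^sup>2) r"
    unfolding sq martingale_sum_Suc \<beta>'_def by (simp add: exp_add del: times_complex.sel)
  also have "\<dots> \<le> (1 + 4 * (norm (\<beta> 0))\<^sup>2) * (\<Sum>n. (norm (c n))\<^sup>2)"
    by (rule exp_mean_step[OF Suc.prems(1) c S(1) Suc.prems(2,3)])
  also have "\<dots> \<le> exp (4 * (norm (\<beta> 0))\<^sup>2) * K"
    using S by (intro mult_mono exp_ge_add_one_self) (auto intro: suminf_nonneg)
  also have "\<dots> = exp (4 * (\<Sum>n<Suc N. (norm (\<beta> n))\<^sup>2))"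
    unfolding K_def \<beta>'_def sum.lessThan_Suc_shift by (simp add: exp_add distrib_left)
  finally show ?case .
qed

end

section \<open>Norm estimates for martingale series\<close>

lemma nn_integral_radial:
  assumes "continuous_on (ball 0 1) F" "0 < p" "0 \<le> r" "r < 1"
  shows "(\<integral>\<^sup>+\<xi>. ennreal (norm (F (complex_of_real r * \<xi>)) powr p) \<partial>circle_measure)
     = ennreal (circle_mean (\<lambda>z. norm (F z) powr p) r)"
  unfolding circle_mean_def
  by (intro nn_integral_eq_integral AE_I2 powr_ge_zero
        integrable_radial[of "\<lambda>z. norm (F z) powr p"] continuous_on_norm_powr assms)

lemma hardy_norm_le:
  assumes F: "F holomorphic_on ball 0 1" and p: "0 < p" and B: "0 \<le> B"
    and le: "\<And>r. 0 \<le> r \<Longrightarrow> r < 1 \<Longrightarrow> circle_mean (\<lambda>z. norm (F z) powr p) r \<le> B powr p"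
  shows "F \<in> hardy_space p" "hardy_norm p F \<le> B"
proof -
  have "hardy_mean_sup p F \<le> ennreal (B powr p)"
    unfolding hardy_mean_sup_def
    by (rule SUP_least)
       (use le p in \<open>simp add: nn_integral_radial holomorphic_on_imp_continuous_on[OF F] ennreal_leI\<close>)
  then show "F \<in> hardy_space p"
    using F unfolding hardy_space_def by (auto intro: le_less_trans)
  have "enn2real (hardy_mean_sup p F) \<le> B powr p"
    by (rule enn2real_leI) (use \<open>hardy_mean_sup p F \<le> ennreal (B powr p)\<close> in auto)
  then have "hardy_norm p F \<le> (B powr p) powr (1 / p)"
    unfolding hardy_norm_def using p by (intro powr_mono2) auto
  also have "\<dots> = B"
    using B p by (simp add: powr_powr)
  finally show "hardy_norm p F \<le> B" .
qed

lemma circle_mean_le_hardy_norm: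
  assumes F: "F \<in> hardy_space p" and p: "0 < p" and r: "0 \<le> r" "r < 1"
  shows "circle_mean (\<lambda>z. norm (F z) powr p) r \<le> hardy_norm p F powr p"
proof -
  have fin: "hardy_mean_sup p F < \<infinity>" and cont: "continuous_on (ball 0 1) F"
    using F by (auto simp: hardy_space_def intro: holomorphic_on_imp_continuous_on)
  have "ennreal (circle_mean (\<lambda>z. norm (F z) powr p) r) \<le> hardy_mean_sup p F"
    unfolding hardy_mean_sup_def nn_integral_radial[OF cont p r, symmetric]
    by (rule SUP_upper) (use r in auto)
  \<comment> \<open>Finiteness is essential here: \<open>enn2real\<close> would turn an infinite
    supremum into 0.\<close>
  also have "\<dots> = ennreal (enn2real (hardy_mean_sup p F))"
    using fin by simp
  finally have "circle_mean (\<lambda>z. norm (F z) powr p) r \<le> enn2real (hardy_mean_sup p F)"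
    by (simp add: ennreal_le_iff)
  also have "\<dots> = hardy_norm p F powr p"
    unfolding hardy_norm_def using p by (simp add: powr_powr)
  finally show ?thesis .
qed

lemma hardy_mean_sup_cong:
  assumes "\<And>z. norm z < 1 \<Longrightarrow> F z = G z"
  shows "hardy_mean_sup p F = hardy_mean_sup p G"
  unfolding hardy_mean_sup_def
  by (intro SUP_cong refl nn_integral_cong) (use assms in \<open>auto simp: norm_mult\<close>)

text \<open>A pointwise substitute for Hoelder interpolation: values up to \<open>\<delta>\<close>
  are paid for by the constant, values between \<open>\<delta>\<close> and \<open>K\<close> by the
  \<open>p\<close>-th power, larger ones by the fourth power. It needs no case distinction on
  \<open>p\<close>.\<close>

lemma square_le_interpolation:
  fixes x \<delta> K p :: real
  assumes "0 \<le> x" "0 < \<delta>" "\<delta> \<le> K" "0 < p"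
  shows "x\<^sup>2 \<le> \<delta>\<^sup>2 + K\<^sup>2 / \<delta> powr p * x powr p + x powr 4 / K\<^sup>2"
proof -
  have nonneg: "0 \<le> K\<^sup>2 / \<delta> powr p * x powr p" "0 \<le> x powr 4 / K\<^sup>2" "0 \<le> \<delta>\<^sup>2"
    by simp_all
  have K: "0 < K" using assms by simp
  consider "x \<le> \<delta>" | "\<delta> < x" "x \<le> K" | "K < x" by linarith
  then show ?thesis
  proof cases
    case 1
    then have "x\<^sup>2 \<le> \<delta>\<^sup>2" using assms by (intro power_mono) auto
    with nonneg show ?thesis by linarith
  next
    case 2
    then have "x\<^sup>2 * 1 \<le> K\<^sup>2 * (x powr p / \<delta> powr p)"
      using assms by (intro mult_mono power_mono) (auto simp: powr_mono2)
    then have "x\<^sup>2 \<le> K\<^sup>2 / \<delta> powr p * x powr p" by simp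
    with nonneg show ?thesis by linarith
  next
    case 3
    then have "x\<^sup>2 * K\<^sup>2 \<le> x\<^sup>2 * x\<^sup>2"
      using K by (intro mult_left_mono power_mono) auto
    also have "\<dots> = x powr 4"
      using 3 K by (simp add: powr_numeral flip: power_add)
    finally have "x\<^sup>2 \<le> x powr 4 / K\<^sup>2"
      using K by (simp add: field_simps)
    with nonneg show ?thesis by linarith
  qed
qed

section \<open>Decay of the iterates and convergence of martingale series\<close>

locale inner_nonrotation = inner_fixing_origin +
  assumes nonrotation: "\<not> is_rotation f"
begin

lemma Schwarz_strict:
  shows "norm z < 1 \<Longrightarrow> z \<noteq> 0 \<Longrightarrow> norm (f z) < norm z" and "norm (deriv f 0) < 1"
proof -
  have *: "\<not> ((\<exists>z. norm z < 1 \<and> z \<noteq> 0 \<and> norm (f z) = norm z) \<or> norm (deriv f 0) = 1)"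
  proof
    assume "(\<exists>z. norm z < 1 \<and> z \<noteq> 0 \<and> norm (f z) = norm z) \<or> norm (deriv f 0) = 1"
    then obtain c where "\<forall>z. norm z < 1 \<longrightarrow> f z = c * z" "norm c = 1"
      using Schwarz_Lemma(3)[OF holf f_0 f_lt_1, of 0] by auto
    then show False
      using nonrotation by (auto simp: is_rotation_def)
  qed
  then show "norm (deriv f 0) < 1"
    using norm_deriv_le_1 by (auto simp: less_le)
  show "norm (f z) < norm z" if "norm z < 1" "z \<noteq> 0"
    using * norm_f_le[OF that(1)] that by (auto simp: less_le)
qed

text \<open>In the factorisation \<open>f z = z * h z\<close> the strict Schwarz lemma gives |h| < 1
  on the disc, including the origin, where \<open>h 0 = deriv f 0\<close>. The rate is the maximum
  of |h| on the compact disc of radius \<open>r\<close>.\<close>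

lemma iterate_decay:
  assumes "0 \<le> r" "r < 1"
  obtains \<rho> where "0 \<le> \<rho>" "\<rho> < 1" "\<And>n z. norm z \<le> r \<Longrightarrow> norm ((f ^^ n) z) \<le> \<rho> ^ n"
proof -
  obtain h where h: "h holomorphic_on ball 0 1" "\<And>z. norm z < 1 \<Longrightarrow> f z = z * h z" "deriv f 0 = h 0"
    using Schwarz3[OF holf f_0] by blast
  have h_lt: "norm (h z) < 1" if "norm z < 1" for z
  proof (cases "z = 0")
    case True
    then show ?thesis using Schwarz_strict(2) h(3) by simp
  next
    case False
    then show ?thesis
      using Schwarz_strict(1)[OF that False] h(2)[OF that] by (simp add: norm_mult)
  qed
  have "continuous_on (cball 0 r) (\<lambda>z. norm (h z))"
    by (intro continuous_intros continuous_on_subset[OF holomorphic_on_imp_continuous_on[OF h(1)]])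
       (use assms in auto)
  moreover have "cball (0::complex) r \<noteq> {}"
    using assms by simp
  ultimately obtain w where w: "w \<in> cball 0 r" "\<And>z. z \<in> cball 0 r \<Longrightarrow> norm (h z) \<le> norm (h w)"
    using continuous_attains_sup[OF compact_cball] by metis
  show ?thesis
  proof
    show "0 \<le> norm (h w)" by simp
    show "norm (h w) < 1" using h_lt w(1) assms by simp
    fix n and z :: complex assume z: "norm z \<le> r"
    \<comment> \<open>The second conjunct keeps the orbit inside the disc on which |h| is bounded by
      its maximum.\<close>
    have "norm ((f ^^ n) z) \<le> norm (h w) ^ n \<and> norm ((f ^^ n) z) \<le> r"
    proof (induction n)
      case 0
      then show ?case using z assms by simp
    next
      case (Suc n)
      define y where "y = (f ^^ n) z"
      have y: "norm y \<le> r" "norm y \<le> norm (h w) ^ n"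
        using Suc by (auto simp: y_def)
      have "norm (f y) = norm (h y) * norm y"
        using h(2)[of y] y(1) assms by (simp add: norm_mult mult.commute)
      also have "\<dots> \<le> norm (h w) * norm (h w) ^ n"
        using y w(2)[of y] by (intro mult_mono) auto
      finally show ?case
        using norm_f_le[of y] y assms by (simp add: y_def)
    qed
    then show "norm ((f ^^ n) z) \<le> norm (h w) ^ n" ..
  qed
qed

definition martingale_series :: "(nat \<Rightarrow> complex) \<Rightarrow> complex \<Rightarrow> complex" where
  "martingale_series \<beta> z = (\<Sum>n. \<beta> n * martingale_diff ((f ^^ n) z))"

text \<open>Square summable coefficients are bounded, so the decay comes from the iterates alone.
  This one majorant serves pointwise convergence, the Weierstrass test and dominated convergence on
  a circle.\<close>

lemma martingale_term_decay:
  assumes \<beta>: "summable (\<lambda>n. (norm (\<beta> n))\<^sup>2)" and r: "0 \<le> r" "r < 1"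
  obtains \<rho> M where "0 \<le> \<rho>" "\<rho> < 1" "0 \<le> M"
    "\<And>n z. norm z \<le> r \<Longrightarrow> norm (\<beta> n * martingale_diff ((f ^^ n) z)) \<le> M * \<rho> ^ n"
proof -
  obtain \<rho> where \<rho>: "0 \<le> \<rho>" "\<rho> < 1" "\<And>n z. norm z \<le> r \<Longrightarrow> norm ((f ^^ n) z) \<le> \<rho> ^ n"
    using iterate_decay[OF r] by metis
  define B where "B = sqrt (\<Sum>n. (norm (\<beta> n))\<^sup>2)"
  have B: "0 \<le> B"
    unfolding B_def by (intro real_sqrt_ge_zero suminf_nonneg \<beta>) auto
  show ?thesis
  proof (rule that[OF \<rho>(1,2)])
    show "0 \<le> B * 2" using B by simp
    fix n and z :: complex assume z: "norm z \<le> r"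
    have "norm (martingale_diff ((f ^^ n) z)) \<le> 2 * norm ((f ^^ n) z)"
      by (intro norm_martingale_diff_le iterate_lt_1) (use z r in simp)
    also have "\<dots> \<le> 2 * \<rho> ^ n"
      using \<rho>(3)[OF z] by simp
    finally have "norm (\<beta> n * martingale_diff ((f ^^ n) z)) \<le> B * (2 * \<rho> ^ n)"
      unfolding norm_mult using square_summable_bound[OF \<beta>] B
      by (intro mult_mono) (auto simp: B_def)
    then show "norm (\<beta> n * martingale_diff ((f ^^ n) z)) \<le> B * 2 * \<rho> ^ n"
      by simp
  qed
qed

lemma summable_martingale_terms:
  assumes "summable (\<lambda>n. (norm (\<beta> n))\<^sup>2)" "norm z < 1"
  shows "summable (\<lambda>n. \<beta> n * martingale_diff ((f ^^ n) z))"
proof -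
  obtain \<rho> M where \<rho>: "0 \<le> \<rho>" "\<rho> < 1" "0 \<le> M"
    "\<And>n w. norm w \<le> norm z \<Longrightarrow> norm (\<beta> n * martingale_diff ((f ^^ n) w)) \<le> M * \<rho> ^ n"
    using martingale_term_decay[OF assms(1) norm_ge_zero assms(2)] by metis
  have "summable (\<lambda>n. M * \<rho> ^ n)"
    using \<rho>(1,2) by (intro summable_mult summable_geometric) simp
  then show ?thesis
    by (rule summable_comparison_test') (use \<rho>(4) in simp)
qed

lemma martingale_sum_LIMSEQ:
  assumes "summable (\<lambda>n. (norm (\<beta> n))\<^sup>2)" "norm z < 1"
  shows "(\<lambda>N. martingale_sum \<beta> N z) \<longlonglongrightarrow> martingale_series \<beta> z"
  unfolding martingale_sum_def martingale_series_def
  by (rule summable_LIMSEQ[OF summable_martingale_terms[OF assms]])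

lemma martingale_sum_bounded:
  assumes "summable (\<lambda>n. (norm (\<beta> n))\<^sup>2)" and r: "0 \<le> r" "r < 1"
  obtains B where "\<And>N z. norm z \<le> r \<Longrightarrow> norm (martingale_sum \<beta> N z) \<le> B"
proof -
  obtain \<rho> M where \<rho>: "0 \<le> \<rho>" "\<rho> < 1" "0 \<le> M"
    "\<And>n z. norm z \<le> r \<Longrightarrow> norm (\<beta> n * martingale_diff ((f ^^ n) z)) \<le> M * \<rho> ^ n"
    using martingale_term_decay[OF assms] by metis
  have s: "summable (\<lambda>n. M * \<rho> ^ n)"
    using \<rho>(1,2) by (intro summable_mult summable_geometric) simp
  show ?thesis
  proof
    fix N and z :: complex assume "norm z \<le> r"
    then have "norm (martingale_sum \<beta> N z) \<le> (\<Sum>n<N. M * \<rho> ^ n)"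
      unfolding martingale_sum_def by (intro sum_norm_le \<rho>(4))
    also have "\<dots> \<le> (\<Sum>n. M * \<rho> ^ n)"
      using \<rho>(1,3) by (intro sum_le_suminf s) auto
    finally show "norm (martingale_sum \<beta> N z) \<le> (\<Sum>n. M * \<rho> ^ n)" .
  qed
qed

lemma holomorphic_martingale_series:
  assumes \<beta>: "summable (\<lambda>n. (norm (\<beta> n))\<^sup>2)"
  shows "martingale_series \<beta> holomorphic_on ball 0 1"
proof (rule holomorphic_uniform_sequence[OF open_ball holomorphic_martingale_sum])
  fix x :: complex assume x: "x \<in> ball 0 1"
  define r where "r = (1 + norm x) / 2"
  have r: "0 \<le> r" "r < 1" using x by (auto simp: r_def)
  obtain \<rho> M where \<rho>: "0 \<le> \<rho>" "\<rho> < 1" "0 \<le> M"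
    "\<And>n z. norm z \<le> r \<Longrightarrow> norm (\<beta> n * martingale_diff ((f ^^ n) z)) \<le> M * \<rho> ^ n"
    using martingale_term_decay[OF \<beta> r] by metis
  have le: "norm z \<le> r" if "z \<in> cball x ((1 - norm x) / 2)" for z
    using that norm_triangle_ineq2[of z x] by (simp add: r_def dist_norm norm_minus_commute field_simps)
  have "uniform_limit (cball x ((1 - norm x) / 2)) (martingale_sum \<beta>) (martingale_series \<beta>) sequentially"
    unfolding martingale_sum_def[abs_def] martingale_series_def[abs_def]
  proof (rule Weierstrass_m_test)
    show "summable (\<lambda>n. M * \<rho> ^ n)"
      using \<rho>(1,2) by (intro summable_mult summable_geometric) simp
  qed (use le \<rho>(4) in blast)
  moreover have "cball x ((1 - norm x) / 2) \<subseteq> ball 0 1"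
    using le r by force
  ultimately show "\<exists>d>0. cball x d \<subseteq> ball 0 1 \<and>
      uniform_limit (cball x d) (martingale_sum \<beta>) (martingale_series \<beta>) sequentially"
    using x by (intro exI[of _ "(1 - norm x) / 2"]) auto
qed

lemma continuous_martingale_series:
  "summable (\<lambda>n. (norm (\<beta> n))\<^sup>2) \<Longrightarrow> continuous_on (ball 0 1) (martingale_series \<beta>)"
  by (intro holomorphic_on_imp_continuous_on holomorphic_martingale_series)

lemma martingale_series_Suc:
  assumes "summable (\<lambda>n. (norm (\<beta> n))\<^sup>2)" "norm z < 1"
  shows "martingale_series \<beta> z = \<beta> 0 * martingale_diff z + martingale_series (\<lambda>n. \<beta> (Suc n)) (f z)"
  using suminf_split_head[OF summable_martingale_terms[OF assms]]
  unfolding martingale_series_def by (simp add: funpow_swap1)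

section \<open>Power means of martingale series, from above and below\<close>

text \<open>The normalisation \<open>1 / 4\<close> makes every coefficient at most
  \<open>1 / 2\<close>, as the Azuma step requires, and the exponent in
  \<open>exp_mean_martingale_sum\<close> at most 1. Multiplying the coefficients by a unit preserves
  both, so each of the four exponential means is at most \<open>exp 1\<close>; finite sums pass to
  the series at fixed radius.\<close>

lemma power_mean_bounded:
  assumes "0 < p"
  obtains C where "0 < C" "\<And>\<beta> r. summable (\<lambda>n. (norm (\<beta> n))\<^sup>2) \<Longrightarrow> (\<Sum>n. (norm (\<beta> n))\<^sup>2) \<le> 1 / 4 \<Longrightarrow>
      0 \<le> r \<Longrightarrow> r < 1 \<Longrightarrow> circle_mean (\<lambda>z. norm (martingale_series \<beta> z) powr p) r \<le> C"
proof -
  obtain C :: real where C: "0 < C" "\<And>w::complex. norm w powr p \<le>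
    C * (exp (Re (1 * w)) + exp (Re (- 1 * w)) + exp (Re (\<i> * w)) + exp (Re (- \<i> * w)))"
    using norm_powr_le_exp[OF assms] by metis
  show ?thesis
  proof
    show "0 < C * (4 * exp 1)" using C by simp
    fix \<beta> :: "nat \<Rightarrow> complex" and r :: real
    assume \<beta>: "summable (\<lambda>n. (norm (\<beta> n))\<^sup>2)" and le: "(\<Sum>n. (norm (\<beta> n))\<^sup>2) \<le> 1 / 4"
      and r: "0 \<le> r" "r < 1"
    have half: "norm (\<beta> n) \<le> 1 / 2" for n
      using order_trans[OF square_summable_bound[OF \<beta>] real_sqrt_le_mono[OF le]]
      by (simp add: real_sqrt_divide)
    define S where "S N = martingale_sum \<beta> N" for N
    have contS: "continuous_on (ball 0 1) (S N)" for N
      unfolding S_def by (intro holomorphic_on_imp_continuous_on holomorphic_martingale_sum)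
    define E where "E u N = circle_mean (\<lambda>z. exp (Re (u * S N z))) r" for u N
    have E: "E u N \<le> exp 1" if "norm u = 1" for u N
    proof -
      have "E u N = circle_mean (\<lambda>z. exp (Re (martingale_sum (\<lambda>n. u * \<beta> n) N z))) r"
        unfolding E_def S_def martingale_sum_def by (simp add: sum_distrib_left mult.assoc)
      also have "\<dots> \<le> exp (4 * (\<Sum>n<N. (norm (u * \<beta> n))\<^sup>2))"
        by (intro exp_mean_martingale_sum r) (use half that in \<open>simp add: norm_mult\<close>)
      also have "\<dots> \<le> exp 1"
        using sum_le_suminf[OF \<beta>, of "{..<N}"] le that by (simp add: norm_mult)
      finally show ?thesis .
    qed
    have bound: "circle_mean (\<lambda>z. norm (S N z) powr p) r \<le> C * (4 * exp 1)" for N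
    proof -
      have "circle_mean (\<lambda>z. norm (S N z) powr p) r \<le>
          circle_mean (\<lambda>z. C * (exp (Re (1 * S N z)) + exp (Re (- 1 * S N z))
             + exp (Re (\<i> * S N z)) + exp (Re (- \<i> * S N z)))) r"
        by (intro circle_mean_mono r C(2) continuous_on_norm_powr assms continuous_intros contS)
      also have "\<dots> = C * (E 1 N + E (- 1) N + E \<i> N + E (- \<i>) N)"
        unfolding E_def circle_mean_mult_left
        by (subst circle_mean_add, (intro continuous_intros contS r)+)+ (rule refl)
      also have "\<dots> \<le> C * (4 * exp 1)"
        using E[of 1 N] E[of "- 1" N] E[of \<i> N] E[of "- \<i>" N] C(1) by (intro mult_left_mono) auto
      finally show ?thesis .
    qed
    obtain B where B: "\<And>N z. norm z \<le> r \<Longrightarrow> norm (S N z) \<le> B"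
      unfolding S_def using martingale_sum_bounded[OF \<beta> r] by metis
    have "(\<lambda>N. circle_mean (\<lambda>z. norm (S N z) powr p) r)
        \<longlonglongrightarrow> circle_mean (\<lambda>z. norm (martingale_series \<beta> z) powr p) r"
    proof (rule circle_mean_tendsto[OF _ _ r])
      fix z :: complex and N assume z: "norm z = r"
      show "(\<lambda>N. norm (S N z) powr p) \<longlonglongrightarrow> norm (martingale_series \<beta> z) powr p"
        unfolding S_def
        by (intro tendsto_powr' tendsto_norm martingale_sum_LIMSEQ \<beta> tendsto_const)
           (use assms z r in auto)
      show "norm (norm (S N z) powr p) \<le> B powr p"
        using B[of z N] z assms by (simp add: powr_mono2)
    qed (intro continuous_on_norm_powr contS continuous_martingale_series \<beta> assms)+
    then show "circle_mean (\<lambda>z. norm (martingale_series \<beta> z) powr p) r \<le> C * (4 * exp 1)"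
      by (rule LIMSEQ_le_const2) (use bound in auto)
  qed
qed

text \<open>Pythagoras, one term at a time: in the limit the square mean splits into that of the
  first term, the square norm of the remaining series, and a cross term that vanishes.\<close>

lemma square_mean_lower:
  assumes "summable (\<lambda>n. (norm (\<beta> n))\<^sup>2)" "(\<Sum>n. (norm (\<beta> n))\<^sup>2) \<le> 1 / 4"
    and "\<And>r. 0 \<le> r \<Longrightarrow> r < 1 \<Longrightarrow> circle_mean (\<lambda>z. (norm (martingale_series \<beta> z))\<^sup>2) r \<le> K"
  shows "(1 - (norm (deriv f 0))\<^sup>2) * (\<Sum>n<N. (norm (\<beta> n))\<^sup>2) \<le> K"
  using assms
proof (induction N arbitrary: \<beta> K)
  case 0
  \<comment> \<open>The base case asks for \<open>0 \<le> K\<close>; the hypothesis at radius 0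
    provides it.\<close>
  have "0 \<le> circle_mean (\<lambda>z. (norm (martingale_series \<beta> z))\<^sup>2) 0"
    unfolding circle_mean_def by (intro Bochner_Integration.integral_nonneg) simp
  with 0 show ?case by (force intro: order_trans)
next
  case (Suc N)
  note \<beta> = Suc.prems(1)
  define q where "q = 1 - (norm (deriv f 0))\<^sup>2"
  define \<beta>' where "\<beta>' n = \<beta> (Suc n)" for n
  define d where "d = martingale_diff"
  define h where "h = martingale_series \<beta>'"
  have \<beta>': "summable (\<lambda>n. (norm (\<beta>' n))\<^sup>2)"
    unfolding \<beta>'_def using summable_Suc_iff[of "\<lambda>n. (norm (\<beta> n))\<^sup>2"] \<beta> by simp
  have le: "(\<Sum>n. (norm (\<beta>' n))\<^sup>2) \<le> 1 / 4"
    using suminf_split_head[OF \<beta>] Suc.prems(2) zero_le_power2[of "norm (\<beta> 0)"]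
    unfolding \<beta>'_def by linarith
  have holh: "h holomorphic_on ball 0 1"
    unfolding h_def by (rule holomorphic_martingale_series[OF \<beta>'])
  then obtain c where c: "taylor c h"
    using holomorphic_imp_taylor by blast
  \<comment> \<open>The exponential estimate at exponent 2 is what makes the Taylor coefficients of
    \<open>h\<close> square summable. The bound \<open>1 / 4\<close> is carried through the
    induction for this purpose.\<close>
  obtain C where "\<And>r. 0 \<le> r \<Longrightarrow> r < 1 \<Longrightarrow> circle_mean (\<lambda>z. norm (h z) powr 2) r \<le> C"
    unfolding h_def using power_mean_bounded[of 2] \<beta>' le by (metis zero_less_numeral)
  then have c2: "summable (\<lambda>n. (norm (c n))\<^sup>2)"
    unfolding norm_powr_2 by (rule bounded_square_mean(1)[OF c])
  define S where "S = (\<Sum>n. (norm (c n))\<^sup>2)"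
  \<comment> \<open>The induction hypothesis is used with \<open>K\<close> equal to
    \<open>S\<close>, the squared norm of \<open>h\<close>.\<close>
  have IH: "q * (\<Sum>n<N. (norm (\<beta>' n))\<^sup>2) \<le> S"
    unfolding q_def S_def
    by (rule Suc.IH[OF \<beta>' le]) (use square_mean_le_suminf[OF c c2] in \<open>simp add: h_def\<close>)
  have hol: "(\<lambda>z. h (f z)) holomorphic_on ball 0 1"
    by (rule holomorphic_compose[OF holh])
  note cont = holomorphic_on_imp_continuous_on[OF hol] continuous_martingale_diff[folded d_def]
  define R where "R r = (norm (\<beta> 0))\<^sup>2 * circle_mean (\<lambda>z. (norm (d z))\<^sup>2) r
      + circle_mean (\<lambda>z. (norm (h (f z)))\<^sup>2) r
      + 2 * Re (\<beta> 0 * circle_mean (\<lambda>z. d z * cnj (h (f z))) r)" for r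
  have eq: "circle_mean (\<lambda>z. (norm (martingale_series \<beta> z))\<^sup>2) r = R r" if r: "0 \<le> r" "r < 1" for r
  proof -
    have "circle_mean (\<lambda>z. (norm (martingale_series \<beta> z))\<^sup>2) r
        = circle_mean (\<lambda>z. (norm (\<beta> 0))\<^sup>2 * (norm (d z))\<^sup>2 + (norm (h (f z)))\<^sup>2
             + 2 * Re (\<beta> 0 * (d z * cnj (h (f z))))) r"
    proof (rule circle_mean_cong[OF _ r])
      fix z :: complex assume z: "norm z < 1"
      have "martingale_series \<beta> z = \<beta> 0 * d z + h (f z)"
        using martingale_series_Suc[OF \<beta> z] by (simp add: d_def h_def \<beta>'_def[abs_def])
      moreover have "(norm (v + w))\<^sup>2 = (norm v)\<^sup>2 + (norm w)\<^sup>2 + 2 * Re (v * cnj w)" for v w :: complex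
        unfolding cmod_power2 by (simp add: power2_eq_square algebra_simps)
      ultimately show "(norm (martingale_series \<beta> z))\<^sup>2 = (norm (\<beta> 0))\<^sup>2 * (norm (d z))\<^sup>2
          + (norm (h (f z)))\<^sup>2 + 2 * Re (\<beta> 0 * (d z * cnj (h (f z))))"
        by (simp add: norm_mult power_mult_distrib algebra_simps)
    qed
    also have "\<dots> = R r"
      unfolding R_def circle_mean_mult_left[symmetric]
      by (subst circle_mean_Re[symmetric], (intro continuous_intros cont r)+,
          subst circle_mean_mult_left[symmetric])
         ((subst circle_mean_add[symmetric], (intro continuous_intros cont r)+)+, rule refl)
    finally show ?thesis .
  qed
  have lim_h: "((\<lambda>r. circle_mean (\<lambda>z. (norm (h (f z)))\<^sup>2) r) \<longlongrightarrow> S) (at_left 1)"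
  proof -
    have "((\<lambda>r. circle_mean (\<lambda>z. 1 * complex_of_real ((norm (h (f z)))\<^sup>2)) r) \<longlongrightarrow> 1 * of_real S) (at_left 1)"
      unfolding S_def
      by (rule weighted_square_mean_tendsto[OF _ _ _ c c2, of _ 1]) (use moment_power in simp_all)
    then show ?thesis
      unfolding mult_1 circle_mean_of_real tendsto_of_real_iff .
  qed
  have "(R \<longlongrightarrow> (norm (\<beta> 0))\<^sup>2 * q + S + 2 * Re (\<beta> 0 * 0)) (at_left 1)"
    unfolding R_def[abs_def] q_def d_def
    by (intro tendsto_intros square_mean_martingale_diff lim_h cross_mean_tendsto[OF c c2])
  moreover have "\<forall>\<^sub>F r in at_left 1. R r \<le> K"
    by (rule eventually_at_left_1) (use eq Suc.prems(3) in simp)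
  ultimately have "(norm (\<beta> 0))\<^sup>2 * q + S + 2 * Re (\<beta> 0 * 0) \<le> K"
    by (rule tendsto_upperbound) simp
  then show ?case
    using IH unfolding q_def[symmetric] sum.lessThan_Suc_shift \<beta>'_def
    by (simp add: distrib_left mult.commute)
qed

lemma martingale_series_scale:
  assumes "summable (\<lambda>n. (norm (\<beta> n))\<^sup>2)" "norm z < 1"
  shows "martingale_series (\<lambda>n. c * \<beta> n) z = c * martingale_series \<beta> z"
  unfolding martingale_series_def
  using suminf_mult[OF summable_martingale_terms[OF assms], of c] by (simp add: mult.assoc)

text \<open>The factor \<open>t\<close> brings the square sum to exactly \<open>1 / 4\<close>, the
  normalisation under which the martingale estimates are proved; homogeneity then removes
  it.\<close>

lemma scaled_coefficients:
  fixes \<beta> :: "nat \<Rightarrow> complex"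
  assumes "summable (\<lambda>n. (norm (\<beta> n))\<^sup>2)" "(\<Sum>n. (norm (\<beta> n))\<^sup>2) \<noteq> 0"
  defines "t \<equiv> 1 / (2 * sqrt (\<Sum>n. (norm (\<beta> n))\<^sup>2))"
  shows "0 < t" "summable (\<lambda>n. (norm (of_real t * \<beta> n))\<^sup>2)"
    "(\<Sum>n. (norm (of_real t * \<beta> n))\<^sup>2) = 1 / 4"
    "\<And>z p. norm z < 1 \<Longrightarrow> norm (martingale_series (\<lambda>n. of_real t * \<beta> n) z) powr p
       = t powr p * norm (martingale_series \<beta> z) powr p"
proof -
  define S where "S = (\<Sum>n. (norm (\<beta> n))\<^sup>2)"
  have S: "0 < S"
    using assms(2) suminf_nonneg[OF assms(1)] by (simp add: S_def less_le)
  then show t: "0 < t" by (simp add: t_def S_def)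
  have eq: "(\<lambda>n. (norm (of_real t * \<beta> n))\<^sup>2) = (\<lambda>n. t\<^sup>2 * (norm (\<beta> n))\<^sup>2)"
    by (simp add: norm_mult power_mult_distrib)
  show "summable (\<lambda>n. (norm (of_real t * \<beta> n))\<^sup>2)"
    unfolding eq by (intro summable_mult assms(1))
  have "(\<Sum>n. (norm (of_real t * \<beta> n))\<^sup>2) = t\<^sup>2 * S"
    unfolding eq S_def by (rule suminf_mult[OF assms(1)])
  also have "\<dots> = 1 / 4"
    using S by (simp add: t_def power_divide power_mult_distrib flip: S_def)
  finally show "(\<Sum>n. (norm (of_real t * \<beta> n))\<^sup>2) = 1 / 4" .
  show "norm (martingale_series (\<lambda>n. of_real t * \<beta> n) z) powr p
       = t powr p * norm (martingale_series \<beta> z) powr p" if "norm z < 1" for z p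
    using t by (simp add: martingale_series_scale[OF assms(1) that] norm_mult powr_mult)
qed

lemma power_mean_upper:
  assumes "0 < p"
  obtains C where "0 < C" "\<And>\<beta> r. summable (\<lambda>n. (norm (\<beta> n))\<^sup>2) \<Longrightarrow> 0 \<le> r \<Longrightarrow> r < 1 \<Longrightarrow>
     circle_mean (\<lambda>z. norm (martingale_series \<beta> z) powr p) r
       \<le> (C * sqrt (\<Sum>n. (norm (\<beta> n))\<^sup>2)) powr p"
proof -
  obtain C where C: "0 < C" "\<And>\<beta> r. summable (\<lambda>n. (norm (\<beta> n))\<^sup>2) \<Longrightarrow> (\<Sum>n. (norm (\<beta> n))\<^sup>2) \<le> 1 / 4 \<Longrightarrow>
      0 \<le> r \<Longrightarrow> r < 1 \<Longrightarrow> circle_mean (\<lambda>z. norm (martingale_series \<beta> z) powr p) r \<le> C"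
    using power_mean_bounded[OF assms] by metis
  show ?thesis
  proof
    \<comment> \<open>The 2 is the reciprocal of the normalised norm
      \<open>sqrt (1 / 4)\<close>.\<close>
    show "0 < C powr (1 / p) * 2" using C by simp
    fix \<beta> :: "nat \<Rightarrow> complex" and r :: real
    assume \<beta>: "summable (\<lambda>n. (norm (\<beta> n))\<^sup>2)" and r: "0 \<le> r" "r < 1"
    define S where "S = (\<Sum>n. (norm (\<beta> n))\<^sup>2)"
    have S0: "0 \<le> S" unfolding S_def by (intro suminf_nonneg \<beta>) auto
    show "circle_mean (\<lambda>z. norm (martingale_series \<beta> z) powr p) r
       \<le> (C powr (1 / p) * 2 * sqrt (\<Sum>n. (norm (\<beta> n))\<^sup>2)) powr p"
    proof (cases "S = 0")
      case True
      then have "\<beta> n = 0" for n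
        using square_summable_bound[OF \<beta>, of n] by (simp add: S_def)
      then show ?thesis
        using assms by (simp add: martingale_series_def)
    next
      case False
      define t where "t = 1 / (2 * sqrt S)"
      note t = scaled_coefficients[OF \<beta> False[unfolded S_def], folded S_def, folded t_def]
      have "t powr p * circle_mean (\<lambda>z. norm (martingale_series \<beta> z) powr p) r
          = circle_mean (\<lambda>z. norm (martingale_series (\<lambda>n. of_real t * \<beta> n) z) powr p) r"
        unfolding circle_mean_mult_left[symmetric] by (rule circle_mean_cong[OF _ r]) (simp add: t(4))
      also have "\<dots> \<le> C"
        by (rule C(2)[OF t(2) _ r]) (simp add: t(3))
      finally have "circle_mean (\<lambda>z. norm (martingale_series \<beta> z) powr p) r \<le> C / t powr p"
        using t(1) by (simp add: field_simps)
      also have "\<dots> = (C powr (1 / p) * 2 * sqrt S) powr p"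
        using C(1) S0 assms unfolding t_def by (simp add: powr_mult powr_divide powr_powr)
      finally show ?thesis unfolding S_def .
    qed
  qed
qed

text \<open>With square sum \<open>1 / 4\<close>, orthogonality forces any bound on the square means
  to be at least \<open>q / 4\<close>. Pointwise interpolation supplies the bound
  \<open>q / 8 + A * B powr p\<close>, so the \<open>p\<close>-th means must account for the missing
  \<open>q / 8\<close>.\<close>

lemma power_mean_lower:
  assumes p: "0 < p"
  obtains c where "0 < c" "\<And>\<beta> B. summable (\<lambda>n. (norm (\<beta> n))\<^sup>2) \<Longrightarrow> 0 \<le> B \<Longrightarrow>
     (\<And>r. 0 \<le> r \<Longrightarrow> r < 1 \<Longrightarrow> circle_mean (\<lambda>z. norm (martingale_series \<beta> z) powr p) r \<le> B powr p) \<Longrightarrow>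
     c * sqrt (\<Sum>n. (norm (\<beta> n))\<^sup>2) \<le> B"
proof -
  define q where "q = 1 - (norm (deriv f 0))\<^sup>2"
  have q: "0 < q"
    using Schwarz_strict(2) by (simp add: q_def power_less_one_iff)
  obtain C where C: "0 < C" "\<And>\<beta> r. summable (\<lambda>n. (norm (\<beta> n))\<^sup>2) \<Longrightarrow> (\<Sum>n. (norm (\<beta> n))\<^sup>2) \<le> 1 / 4 \<Longrightarrow>
      0 \<le> r \<Longrightarrow> r < 1 \<Longrightarrow> circle_mean (\<lambda>z. norm (martingale_series \<beta> z) powr 4) r \<le> C"
    using power_mean_bounded[of 4] by (metis zero_less_numeral)
  \<comment> \<open>Small values may consume \<open>\<delta>\<^sup>2 = q / 16\<close>.\<close>
  define \<delta> where "\<delta> = sqrt (q / 16)"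
  \<comment> \<open>The second entry makes the share \<open>C / K\<^sup>2\<close> of the fourth
    power at most \<open>q / 16\<close>; the maximum secures \<open>\<delta> \<le> K\<close> for the
    interpolation.\<close>
  define K where "K = max \<delta> (sqrt (16 * C / q))"
  have \<delta>: "0 < \<delta>" "\<delta>\<^sup>2 = q / 16" "\<delta> \<le> K"
    using q by (auto simp: \<delta>_def K_def)
  have K: "0 < K" using \<delta> by simp
  have CK: "C / K\<^sup>2 \<le> q / 16"
  proof -
    have "(sqrt (16 * C / q))\<^sup>2 \<le> K\<^sup>2"
      by (intro power_mono) (use q C in \<open>auto simp: K_def\<close>)
    then have "16 * C / q \<le> K\<^sup>2" using q C by simp
    then show ?thesis using q K by (simp add: field_simps)
  qed
  define A where "A = K\<^sup>2 / \<delta> powr p"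
  have A: "0 < A" using K \<delta> by (simp add: A_def)
  \<comment> \<open>The solution of \<open>q / 4 = q / 8 + A * b powr p\<close>.\<close>
  define b where "b = (q / (8 * A)) powr (1 / p)"
  have b: "0 < b" using q A by (simp add: b_def)
  have bp: "b powr p = q / (8 * A)"
    using q A p by (simp add: b_def powr_powr)
  have normalized: "b \<le> B"
    if \<beta>: "summable (\<lambda>n. (norm (\<beta> n))\<^sup>2)" "(\<Sum>n. (norm (\<beta> n))\<^sup>2) = 1 / 4" and B: "0 \<le> B"
      and le: "\<And>r. 0 \<le> r \<Longrightarrow> r < 1 \<Longrightarrow> circle_mean (\<lambda>z. norm (martingale_series \<beta> z) powr p) r \<le> B powr p"
    for \<beta> B
  proof -
    note cont = continuous_martingale_series[OF \<beta>(1)]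
    have cont_powr: "continuous_on (ball 0 1) (\<lambda>z. norm (martingale_series \<beta> z) powr p)"
      "continuous_on (ball 0 1) (\<lambda>z. norm (martingale_series \<beta> z) powr 4)"
      using continuous_on_norm_powr[OF cont p] continuous_on_norm_powr[OF cont, of 4] by simp_all
    have pointwise: "(norm w)\<^sup>2 \<le> \<delta>\<^sup>2 + A * norm w powr p + inverse (K\<^sup>2) * norm w powr 4"
      for w :: complex
      using square_le_interpolation[OF norm_ge_zero[of w] \<delta>(1,3) p]
      unfolding A_def divide_inverse by (simp only: mult_ac)
    have "circle_mean (\<lambda>z. (norm (martingale_series \<beta> z))\<^sup>2) r \<le> q / 8 + A * B powr p"
      if r: "0 \<le> r" "r < 1" for r
    proof -
      have "circle_mean (\<lambda>z. (norm (martingale_series \<beta> z))\<^sup>2) r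
          \<le> circle_mean (\<lambda>z. \<delta>\<^sup>2 + A * norm (martingale_series \<beta> z) powr p
                + inverse (K\<^sup>2) * norm (martingale_series \<beta> z) powr 4) r"
        by (rule circle_mean_mono[OF _ _ r])
           (intro continuous_on_add continuous_on_mult_left continuous_on_const cont_powr
              continuous_intros cont pointwise)+
      also have "\<dots> = \<delta>\<^sup>2 + A * circle_mean (\<lambda>z. norm (martingale_series \<beta> z) powr p) r
                + inverse (K\<^sup>2) * circle_mean (\<lambda>z. norm (martingale_series \<beta> z) powr 4) r"
        by ((subst circle_mean_add, (intro continuous_on_add continuous_on_mult_left
              continuous_on_const cont_powr r)+)+, simp)
      also have "\<dots> \<le> q / 16 + A * B powr p + inverse (K\<^sup>2) * C"
        using \<delta>(2) A K by (intro add_mono mult_left_mono le C(2) \<beta>(1) r) (auto simp: \<beta>(2))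
      also have "\<dots> \<le> q / 8 + A * B powr p"
        using CK unfolding divide_inverse by (simp add: mult.commute)
      finally show ?thesis .
    qed
    then have le: "q * (\<Sum>n<N. (norm (\<beta> n))\<^sup>2) \<le> q / 8 + A * B powr p" for N
      unfolding q_def[symmetric] by (intro square_mean_lower[folded q_def] \<beta>(1)) (simp_all add: \<beta>(2))
    have "(\<lambda>N. q * (\<Sum>n<N. (norm (\<beta> n))\<^sup>2)) \<longlonglongrightarrow> q * (1 / 4)"
      using summable_LIMSEQ[OF \<beta>(1)] unfolding \<beta>(2) by (intro tendsto_intros)
    then have "q * (1 / 4) \<le> q / 8 + A * B powr p"
      by (rule LIMSEQ_le_const2) (use le in auto)
    then have "b powr p \<le> B powr p"
      unfolding bp using A by (simp add: field_simps)
    then show "b \<le> B"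
      using b B p by (meson not_less powr_less_mono2)
  qed
  show ?thesis
  proof
    \<comment> \<open>The factor 2 undoes the normalised norm \<open>sqrt (1 / 4)\<close>.\<close>
    show "0 < 2 * b" using b by simp
    fix \<beta> :: "nat \<Rightarrow> complex" and B :: real
    assume \<beta>: "summable (\<lambda>n. (norm (\<beta> n))\<^sup>2)" and B: "0 \<le> B"
      and le: "\<And>r. 0 \<le> r \<Longrightarrow> r < 1 \<Longrightarrow> circle_mean (\<lambda>z. norm (martingale_series \<beta> z) powr p) r \<le> B powr p"
    define S where "S = (\<Sum>n. (norm (\<beta> n))\<^sup>2)"
    have S0: "0 \<le> S" unfolding S_def by (intro suminf_nonneg \<beta>) auto
    show "2 * b * sqrt (\<Sum>n. (norm (\<beta> n))\<^sup>2) \<le> B"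
    proof (cases "S = 0")
      case True
      then show ?thesis using B by (simp add: S_def)
    next
      case False
      define t where "t = 1 / (2 * sqrt S)"
      note t = scaled_coefficients[OF \<beta> False[unfolded S_def], folded S_def, folded t_def]
      have "b \<le> t * B"
      proof (rule normalized[OF t(2,3)])
        fix r :: real assume r: "0 \<le> r" "r < 1"
        have "circle_mean (\<lambda>z. norm (martingale_series (\<lambda>n. of_real t * \<beta> n) z) powr p) r
            = t powr p * circle_mean (\<lambda>z. norm (martingale_series \<beta> z) powr p) r"
          unfolding circle_mean_mult_left[symmetric] by (rule circle_mean_cong[OF _ r]) (simp add: t(4))
        also have "\<dots> \<le> t powr p * B powr p"
          by (intro mult_left_mono le r) simp
        also have "\<dots> = (t * B) powr p"
          using t(1) B by (simp add: powr_mult)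
        finally show "circle_mean (\<lambda>z. norm (martingale_series (\<lambda>n. of_real t * \<beta> n) z) powr p) r
            \<le> (t * B) powr p" .
      qed (use t(1) B in simp)
      then have "b * (2 * sqrt S) \<le> B"
        using S0 False by (simp add: t_def field_simps)
      then show ?thesis by (simp add: S_def mult_ac)
    qed
  qed
qed

end

section \<open>Series of iterates\<close>

context inner_nonrotation
begin

primrec martingale_coeff :: "(nat \<Rightarrow> complex) \<Rightarrow> nat \<Rightarrow> complex" where
  "martingale_coeff \<alpha> 0 = \<alpha> 0"
| "martingale_coeff \<alpha> (Suc n) = \<alpha> (Suc n) + cnj (deriv f 0) * martingale_coeff \<alpha> n"

text \<open>The recursion is made for telescoping: each subtracted iterate is absorbed by the next
  coefficient, and a single boundary term remains.\<close>

lemma martingale_sum_coeff: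
  "martingale_sum (martingale_coeff \<alpha>) (Suc N) z
     = (\<Sum>n\<le>N. \<alpha> n * (f ^^ n) z) - cnj (deriv f 0) * martingale_coeff \<alpha> N * (f ^^ Suc N) z"
proof (induction N)
  case 0
  then show ?case by (simp add: martingale_sum_def martingale_diff_def algebra_simps)
next
  case (Suc N)
  then show ?case
    by (simp add: martingale_sum_def martingale_diff_def algebra_simps)
qed

text \<open>The new coefficients are a convolution with a geometric sequence of ratio modulus
  \<open>q = norm (deriv f 0)\<close>, of norm at most 1/(1 - q) on l^2. Conversely each old
  coefficient is a difference of two neighbouring terms with factors of modulus at most 1, which
  costs a factor 2 in norm.\<close>

lemma martingale_coeff_square_summable:
  assumes \<alpha>: "summable (\<lambda>n. (norm (\<alpha> n))\<^sup>2)"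
  shows "summable (\<lambda>n. (norm (martingale_coeff \<alpha> n))\<^sup>2)" (is "summable ?b")
    and "(1 - norm (deriv f 0))\<^sup>2 * (\<Sum>n. (norm (martingale_coeff \<alpha> n))\<^sup>2) \<le> (\<Sum>n. (norm (\<alpha> n))\<^sup>2)"
    and "(\<Sum>n. (norm (\<alpha> n))\<^sup>2) \<le> 4 * (\<Sum>n. (norm (martingale_coeff \<alpha> n))\<^sup>2)"
proof -
  define q where "q = norm (deriv f 0)"
  have q: "0 \<le> q" "q < 1" using Schwarz_strict(2) by (auto simp: q_def)
  define b where "b n = norm (martingale_coeff \<alpha> n)" for n
  define A where "A = (\<Sum>n. (norm (\<alpha> n))\<^sup>2)"
  \<comment> \<open>Convexity of the square, with \<open>x + q * y\<close> read as the combination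
    of \<open>x / (1 - q)\<close> and \<open>y\<close> with weights \<open>1 - q\<close> and
    \<open>q\<close>.\<close>
  have conv: "(x + q * y)\<^sup>2 \<le> x\<^sup>2 / (1 - q) + q * y\<^sup>2" for x y
  proof -
    have "x\<^sup>2 / (1 - q) + q * y\<^sup>2 - (x + q * y)\<^sup>2 = q / (1 - q) * (x - (1 - q) * y)\<^sup>2"
      using q by (simp add: power2_eq_square field_simps)
    also have "0 \<le> \<dots>" using q by simp
    finally show ?thesis by simp
  qed
  have step: "(b (Suc n))\<^sup>2 \<le> (norm (\<alpha> (Suc n)))\<^sup>2 / (1 - q) + q * (b n)\<^sup>2" for n
  proof -
    have "b (Suc n) \<le> norm (\<alpha> (Suc n)) + q * b n"
      unfolding b_def q_def using norm_triangle_ineq[of "\<alpha> (Suc n)" "cnj (deriv f 0) * martingale_coeff \<alpha> n"] by (simp add: norm_mult)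
    then have "(b (Suc n))\<^sup>2 \<le> (norm (\<alpha> (Suc n)) + q * b n)\<^sup>2"
      by (intro power_mono) (auto simp: b_def)
    also note conv
    finally show ?thesis .
  qed
  have part: "(\<Sum>n<N. (b n)\<^sup>2) \<le> A / (1 - q)\<^sup>2" for N
  proof -
    have "(\<Sum>n<Suc N. (b n)\<^sup>2) \<le> (norm (\<alpha> 0))\<^sup>2 / (1 - q) + (\<Sum>n<N. (norm (\<alpha> (Suc n)))\<^sup>2 / (1 - q) + q * (b n)\<^sup>2)"
      unfolding sum.lessThan_Suc_shift
    proof (intro add_mono sum_mono step)
      show "(b 0)\<^sup>2 \<le> (norm (\<alpha> 0))\<^sup>2 / (1 - q)"
        using conv[of "norm (\<alpha> 0)" 0] by (simp add: b_def)
    qed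
    also have "\<dots> = (\<Sum>n<Suc N. (norm (\<alpha> n))\<^sup>2) / (1 - q) + q * (\<Sum>n<N. (b n)\<^sup>2)"
      unfolding sum.lessThan_Suc_shift
      by (simp add: sum.distrib sum_divide_distrib[symmetric] sum_distrib_left[symmetric] add_divide_distrib)
    \<comment> \<open>The last sum is enlarged to the range of the left side so that it can be
      absorbed there; both are finite sums, so no summability is presupposed.\<close>
    also have "\<dots> \<le> A / (1 - q) + q * (\<Sum>n<Suc N. (b n)\<^sup>2)"
      using q sum_le_suminf[OF \<alpha>, of "{..<Suc N}"] unfolding A_def
      by (intro add_mono divide_right_mono mult_left_mono) auto
    finally have "(1 - q) * (\<Sum>n<Suc N. (b n)\<^sup>2) \<le> A / (1 - q)"
      by (simp add: algebra_simps)
    then have "(\<Sum>n<Suc N. (b n)\<^sup>2) \<le> A / (1 - q) / (1 - q)"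
      using q pos_le_divide_eq[of "1 - q" "\<Sum>n<Suc N. (b n)\<^sup>2" "A / (1 - q)"]
      by (simp only: mult.commute diff_gt_0_iff_gt)
    then have "(\<Sum>n<Suc N. (b n)\<^sup>2) \<le> A / (1 - q)\<^sup>2"
      by (simp only: divide_divide_eq_left power2_eq_square)
    then show ?thesis
      using zero_le_power2[of "b N"] unfolding sum.lessThan_Suc by linarith
  qed
  show sb: "summable ?b"
    unfolding b_def[symmetric] by (rule summableI_nonneg_bounded[OF _ part]) simp
  have "(\<Sum>n. (b n)\<^sup>2) \<le> A / (1 - q)\<^sup>2"
    by (rule suminf_le_const[OF _ part]) (use sb in \<open>simp add: b_def\<close>)
  then show "(1 - norm (deriv f 0))\<^sup>2 * (\<Sum>n. ?b n) \<le> (\<Sum>n. (norm (\<alpha> n))\<^sup>2)"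
    unfolding b_def A_def q_def[symmetric] using q by (simp add: field_simps)
  have part': "(\<Sum>n<N. (norm (\<alpha> n))\<^sup>2) \<le> 4 * (\<Sum>n. ?b n)" for N
  proof -
    have a_le: "(norm (\<alpha> (Suc n)))\<^sup>2 \<le> 2 * (b (Suc n))\<^sup>2 + 2 * (b n)\<^sup>2" for n
    proof -
      have "norm (\<alpha> (Suc n)) = norm (martingale_coeff \<alpha> (Suc n) - cnj (deriv f 0) * martingale_coeff \<alpha> n)"
        by simp
      also have "\<dots> \<le> b (Suc n) + q * b n"
        unfolding b_def q_def using norm_triangle_ineq4 norm_mult complex_mod_cnj by metis
      also have "\<dots> \<le> b (Suc n) + 1 * b n"
        using q by (intro add_left_mono mult_right_mono) (auto simp: b_def)
      finally have "(norm (\<alpha> (Suc n)))\<^sup>2 \<le> (b (Suc n) + b n)\<^sup>2"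
        by (intro power_mono) auto
      also have "\<dots> \<le> 2 * (b (Suc n))\<^sup>2 + 2 * (b n)\<^sup>2"
        using sum_squares_bound[of "b (Suc n)" "b n"] by (simp add: power2_sum)
      finally show ?thesis .
    qed
    have "(\<Sum>n<Suc N. (norm (\<alpha> n))\<^sup>2) \<le> 2 * (b 0)\<^sup>2 + (\<Sum>n<N. 2 * (b (Suc n))\<^sup>2 + 2 * (b n)\<^sup>2)"
      unfolding sum.lessThan_Suc_shift by (intro add_mono sum_mono a_le) (simp add: b_def)
    also have "\<dots> = 2 * (\<Sum>n<Suc N. (b n)\<^sup>2) + 2 * (\<Sum>n<N. (b n)\<^sup>2)"
      unfolding sum.lessThan_Suc_shift by (simp add: sum.distrib sum_distrib_left)
    also have "\<dots> \<le> 2 * (\<Sum>n. ?b n) + 2 * (\<Sum>n. ?b n)"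
      unfolding b_def by (intro add_mono mult_left_mono sum_le_suminf sb) auto
    finally have "(\<Sum>n<Suc N. (norm (\<alpha> n))\<^sup>2) \<le> 4 * (\<Sum>n. ?b n)" by simp
    then show ?thesis
      using zero_le_power2[of "norm (\<alpha> N)"] unfolding sum.lessThan_Suc by linarith
  qed
  show "(\<Sum>n. (norm (\<alpha> n))\<^sup>2) \<le> 4 * (\<Sum>n. ?b n)"
    by (rule suminf_le_const[OF \<alpha> part'])
qed

text \<open>At a fixed point the boundary term of \<open>martingale_sum_coeff\<close> tends to 0:
  its coefficient is bounded and the iterate decays geometrically.\<close>

lemma iterate_sums_martingale_series:
  assumes \<alpha>: "summable (\<lambda>n. (norm (\<alpha> n))\<^sup>2)" and z: "norm z < 1"
  shows "(\<lambda>n. \<alpha> n * (f ^^ n) z) sums martingale_series (martingale_coeff \<alpha>) z"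
proof -
  define b where "b = martingale_coeff \<alpha>"
  define B where "B = sqrt (\<Sum>n. (norm (b n))\<^sup>2)"
  note sb = martingale_coeff_square_summable(1)[OF \<alpha>, folded b_def]
  obtain \<rho> where \<rho>: "0 \<le> \<rho>" "\<rho> < 1" "\<And>n. norm ((f ^^ n) z) \<le> \<rho> ^ n"
    using iterate_decay[OF norm_ge_zero z] by (metis order_refl)
  have "(\<lambda>N. cnj (deriv f 0) * b N * (f ^^ Suc N) z) \<longlonglongrightarrow> 0"
  proof (rule Lim_null_comparison)
    show "\<forall>\<^sub>F N in sequentially. norm (cnj (deriv f 0) * b N * (f ^^ Suc N) z) \<le> 1 * B * \<rho> ^ Suc N"
      unfolding norm_mult B_def complex_mod_cnj
      using \<rho> norm_deriv_le_1 square_summable_bound[OF sb] suminf_nonneg[OF sb]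
      by (intro always_eventually allI mult_mono) (auto simp del: funpow.simps power_Suc)
    have "(\<lambda>N. \<rho> ^ N) \<longlonglongrightarrow> 0"
      using \<rho> by (intro LIMSEQ_power_zero) simp
    then show "(\<lambda>N. 1 * B * \<rho> ^ Suc N) \<longlonglongrightarrow> 0"
      by (intro tendsto_mult_right_zero LIMSEQ_Suc)
  qed
  then have "(\<lambda>N. martingale_sum b (Suc N) z + cnj (deriv f 0) * b N * (f ^^ Suc N) z)
      \<longlonglongrightarrow> martingale_series b z + 0"
    by (intro tendsto_add LIMSEQ_Suc martingale_sum_LIMSEQ sb z)
  then show ?thesis
    unfolding b_def martingale_sum_coeff sums_def_le by simp
qed

lemma iterate_series_eq_martingale_series:
  assumes a: "summable (\<lambda>n. (norm (a (Suc n)))\<^sup>2)"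
  obtains \<beta> where "summable (\<lambda>n. (norm (\<beta> n))\<^sup>2)"
    "(1 - norm (deriv f 0)) * sqrt (\<Sum>n. (norm (\<beta> n))\<^sup>2) \<le> sqrt (\<Sum>n. (norm (a (Suc n)))\<^sup>2)"
    "sqrt (\<Sum>n. (norm (a (Suc n)))\<^sup>2) \<le> 2 * sqrt (\<Sum>n. (norm (\<beta> n))\<^sup>2)"
    "\<And>z. norm z < 1 \<Longrightarrow> iterate_series a f z = martingale_series \<beta> z"
    "\<And>z. norm z < 1 \<Longrightarrow> summable (\<lambda>n. a (Suc n) * (f ^^ Suc n) z)"
proof -
  \<comment> \<open>The martingale is indexed from the identity, the zeroth iterate, while the
    series starts with \<open>f\<close>; a zero coefficient in front reconciles the two.\<close>
  define \<alpha> where "\<alpha> = a(0 := 0)"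
  have \<alpha>_Suc: "\<alpha> (Suc n) = a (Suc n)" and \<alpha>_0: "\<alpha> 0 = 0" for n
    by (simp_all add: \<alpha>_def)
  have \<alpha>: "summable (\<lambda>n. (norm (\<alpha> n))\<^sup>2)"
    using a summable_Suc_iff[of "\<lambda>n. (norm (\<alpha> n))\<^sup>2"] by (simp add: \<alpha>_Suc)
  have eq: "(\<Sum>n. (norm (\<alpha> n))\<^sup>2) = (\<Sum>n. (norm (a (Suc n)))\<^sup>2)"
    using suminf_split_head[OF \<alpha>] by (simp add: \<alpha>_Suc \<alpha>_0)
  note \<beta> = martingale_coeff_square_summable[OF \<alpha>, unfolded eq]
  have sums: "(\<lambda>n. a (Suc n) * (f ^^ Suc n) z) sums martingale_series (martingale_coeff \<alpha>) z"
    if "norm z < 1" for z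
    using iterate_sums_martingale_series[OF \<alpha> that] sums_Suc_iff[of "\<lambda>n. \<alpha> n * (f ^^ n) z"]
    by (simp add: \<alpha>_Suc \<alpha>_0)
  show ?thesis
  proof
    show "summable (\<lambda>n. (norm (martingale_coeff \<alpha> n))\<^sup>2)" by (rule \<beta>(1))
    show "(1 - norm (deriv f 0)) * sqrt (\<Sum>n. (norm (martingale_coeff \<alpha> n))\<^sup>2)
        \<le> sqrt (\<Sum>n. (norm (a (Suc n)))\<^sup>2)"
      using real_sqrt_le_mono[OF \<beta>(2)] norm_deriv_le_1 by (simp add: real_sqrt_mult)
    show "sqrt (\<Sum>n. (norm (a (Suc n)))\<^sup>2) \<le> 2 * sqrt (\<Sum>n. (norm (martingale_coeff \<alpha> n))\<^sup>2)"
      using real_sqrt_le_mono[OF \<beta>(3)] by (simp add: real_sqrt_mult)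
    show "iterate_series a f z = martingale_series (martingale_coeff \<alpha>) z" if "norm z < 1" for z
      unfolding iterate_series_def by (rule sums_unique[OF sums[OF that], symmetric])
    show "summable (\<lambda>n. a (Suc n) * (f ^^ Suc n) z)" if "norm z < 1" for z
      by (rule sums_summable[OF sums[OF that]])
  qed
qed

lemma hardy_norm_iterate_series_le:
  assumes p: "0 < p"
  obtains C where "0 < C" "\<And>a. summable (\<lambda>n. (norm (a (Suc n)))\<^sup>2) \<Longrightarrow>
      iterate_series a f \<in> hardy_space p \<and>
      hardy_norm p (iterate_series a f) \<le> C * sqrt (\<Sum>n. (norm (a (Suc n)))\<^sup>2)"
proof -
  obtain C where C: "0 < C" "\<And>\<beta> r. summable (\<lambda>n. (norm (\<beta> n))\<^sup>2) \<Longrightarrow> 0 \<le> r \<Longrightarrow> r < 1 \<Longrightarrow>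
     circle_mean (\<lambda>z. norm (martingale_series \<beta> z) powr p) r
       \<le> (C * sqrt (\<Sum>n. (norm (\<beta> n))\<^sup>2)) powr p"
    using power_mean_upper[OF p] by blast
  define q where "q = 1 - norm (deriv f 0)"
  have q: "0 < q" using Schwarz_strict(2) by (simp add: q_def)
  show ?thesis
  proof
    \<comment> \<open>The divisor \<open>q\<close> is the price of passing from \<open>a\<close> to
      the martingale coefficients.\<close>
    show "0 < C / q" using C q by simp
    fix a :: "nat \<Rightarrow> complex" assume a: "summable (\<lambda>n. (norm (a (Suc n)))\<^sup>2)"
    obtain \<beta> where \<beta>: "summable (\<lambda>n. (norm (\<beta> n))\<^sup>2)"
      "q * sqrt (\<Sum>n. (norm (\<beta> n))\<^sup>2) \<le> sqrt (\<Sum>n. (norm (a (Suc n)))\<^sup>2)"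
      "\<And>z. norm z < 1 \<Longrightarrow> iterate_series a f z = martingale_series \<beta> z"
      unfolding q_def by (rule iterate_series_eq_martingale_series[OF a]) blast
    have nonneg: "0 \<le> (\<Sum>n. (norm (\<beta> n))\<^sup>2)" "0 \<le> (\<Sum>n. (norm (a (Suc n)))\<^sup>2)"
      by (intro suminf_nonneg \<beta>(1) a; simp)+
    have hol: "iterate_series a f holomorphic_on ball 0 1"
      by (rule holomorphic_transform[OF holomorphic_martingale_series[OF \<beta>(1)]]) (simp add: \<beta>(3))
    have le: "circle_mean (\<lambda>z. norm (iterate_series a f z) powr p) r
        \<le> (C / q * sqrt (\<Sum>n. (norm (a (Suc n)))\<^sup>2)) powr p" if r: "0 \<le> r" "r < 1" for r
    proof -
      have "circle_mean (\<lambda>z. norm (iterate_series a f z) powr p) r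
          = circle_mean (\<lambda>z. norm (martingale_series \<beta> z) powr p) r"
        by (rule circle_mean_cong[OF _ r]) (simp add: \<beta>(3))
      also have "\<dots> \<le> (C * sqrt (\<Sum>n. (norm (\<beta> n))\<^sup>2)) powr p"
        by (rule C(2)[OF \<beta>(1) r])
      also have "\<dots> \<le> (C / q * sqrt (\<Sum>n. (norm (a (Suc n)))\<^sup>2)) powr p"
      proof (rule powr_mono2)
        have "C * sqrt (\<Sum>n. (norm (\<beta> n))\<^sup>2) = C / q * (q * sqrt (\<Sum>n. (norm (\<beta> n))\<^sup>2))"
          using q by simp
        also have "\<dots> \<le> C / q * sqrt (\<Sum>n. (norm (a (Suc n)))\<^sup>2)"
          using C q by (intro mult_left_mono \<beta>(2)) auto
        finally show "C * sqrt (\<Sum>n. (norm (\<beta> n))\<^sup>2) \<le> C / q * sqrt (\<Sum>n. (norm (a (Suc n)))\<^sup>2)" .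
      qed (use p C nonneg in auto)
      finally show ?thesis .
    qed
    show "iterate_series a f \<in> hardy_space p \<and>
        hardy_norm p (iterate_series a f) \<le> C / q * sqrt (\<Sum>n. (norm (a (Suc n)))\<^sup>2)"
      using hardy_norm_le[OF hol p _ le] C q nonneg by simp
  qed
qed

lemma hardy_norm_iterate_series_ge:
  assumes p: "0 < p"
  obtains c where "0 < c" "\<And>a. summable (\<lambda>n. (norm (a (Suc n)))\<^sup>2) \<Longrightarrow>
      c * sqrt (\<Sum>n. (norm (a (Suc n)))\<^sup>2) \<le> hardy_norm p (iterate_series a f)"
proof -
  obtain c where c: "0 < c" "\<And>\<beta> B. summable (\<lambda>n. (norm (\<beta> n))\<^sup>2) \<Longrightarrow> 0 \<le> B \<Longrightarrow>
     (\<And>r. 0 \<le> r \<Longrightarrow> r < 1 \<Longrightarrow> circle_mean (\<lambda>z. norm (martingale_series \<beta> z) powr p) r \<le> B powr p) \<Longrightarrow>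
     c * sqrt (\<Sum>n. (norm (\<beta> n))\<^sup>2) \<le> B"
    using power_mean_lower[OF p] by blast
  show ?thesis
  proof
    show "0 < c / 2" using c by simp
    fix a :: "nat \<Rightarrow> complex" assume a: "summable (\<lambda>n. (norm (a (Suc n)))\<^sup>2)"
    obtain \<beta> where \<beta>: "summable (\<lambda>n. (norm (\<beta> n))\<^sup>2)"
      "sqrt (\<Sum>n. (norm (a (Suc n)))\<^sup>2) \<le> 2 * sqrt (\<Sum>n. (norm (\<beta> n))\<^sup>2)"
      "\<And>z. norm z < 1 \<Longrightarrow> iterate_series a f z = martingale_series \<beta> z"
      by (rule iterate_series_eq_martingale_series[OF a]) blast
    have F: "iterate_series a f \<in> hardy_space p"
      by (rule hardy_norm_iterate_series_le[OF p]) (use a in blast)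
    have "c * sqrt (\<Sum>n. (norm (\<beta> n))\<^sup>2) \<le> hardy_norm p (iterate_series a f)"
    proof (rule c(2)[OF \<beta>(1)])
      show "0 \<le> hardy_norm p (iterate_series a f)"
        by (simp add: hardy_norm_def)
      fix r :: real assume r: "0 \<le> r" "r < 1"
      have "circle_mean (\<lambda>z. norm (martingale_series \<beta> z) powr p) r
          = circle_mean (\<lambda>z. norm (iterate_series a f z) powr p) r"
        by (rule circle_mean_cong[OF _ r]) (simp add: \<beta>(3))
      then show "circle_mean (\<lambda>z. norm (martingale_series \<beta> z) powr p) r
          \<le> hardy_norm p (iterate_series a f) powr p"
        using circle_mean_le_hardy_norm[OF F p r] by simp
    qed
    moreover have "c / 2 * sqrt (\<Sum>n. (norm (a (Suc n)))\<^sup>2) \<le> c / 2 * (2 * sqrt (\<Sum>n. (norm (\<beta> n))\<^sup>2))"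
      using c by (intro mult_left_mono \<beta>(2)) auto
    ultimately show "c / 2 * sqrt (\<Sum>n. (norm (a (Suc n)))\<^sup>2) \<le> hardy_norm p (iterate_series a f)"
      by simp
  qed
qed

text \<open>A remainder of the series is itself an iterate series, with the leading coefficients set
  to 0; the upper bound at exponent 2 turns it into a tail of the square sum.\<close>

lemma hardy_sums_iterate_series:
  assumes a: "summable (\<lambda>n. (norm (a (Suc n)))\<^sup>2)"
  shows "hardy_sums 2 (\<lambda>n z. a (Suc n) * (f ^^ Suc n) z) (iterate_series a f)"
proof -
  obtain C where C: "0 < C" "\<And>a. summable (\<lambda>n. (norm (a (Suc n)))\<^sup>2) \<Longrightarrow>
      iterate_series a f \<in> hardy_space 2 \<and>
      hardy_norm 2 (iterate_series a f) \<le> C * sqrt (\<Sum>n. (norm (a (Suc n)))\<^sup>2)"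
    by (rule hardy_norm_iterate_series_le[of 2]) auto
  have summand: "(\<lambda>z. a (Suc n) * (f ^^ Suc n) z) \<in> hardy_space 2" for n
  proof (rule hardy_norm_le(1))
    show hol: "(\<lambda>z. a (Suc n) * (f ^^ Suc n) z) holomorphic_on ball 0 1"
      by (intro holomorphic_intros holomorphic_iterate)
    fix r :: real assume r: "0 \<le> r" "r < 1"
    have "circle_mean (\<lambda>z. norm (a (Suc n) * (f ^^ Suc n) z) powr 2) r
        \<le> circle_mean (\<lambda>z. norm (a (Suc n)) powr 2) r"
    proof (rule circle_mean_mono[OF _ _ r])
      show "continuous_on (ball 0 1) (\<lambda>z. norm (a (Suc n) * (f ^^ Suc n) z) powr 2)"
        by (intro continuous_on_norm_powr holomorphic_on_imp_continuous_on hol) simp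
      fix z :: complex assume "norm z < 1"
      then have "norm ((f ^^ Suc n) z) < 1"
        by (rule iterate_lt_1)
      then show "norm (a (Suc n) * (f ^^ Suc n) z) powr 2 \<le> norm (a (Suc n)) powr 2"
        unfolding norm_mult by (intro powr_mono2 mult_left_le) auto
    qed simp
    then show "circle_mean (\<lambda>z. norm (a (Suc n) * (f ^^ Suc n) z) powr 2) r \<le> norm (a (Suc n)) powr 2"
      by simp
  qed auto
  define A where "A = (\<Sum>n. (norm (a (Suc n)))\<^sup>2)"
  define s where "s N = (\<Sum>n<N. (norm (a (Suc n)))\<^sup>2)" for N
  have le: "hardy_norm 2 (\<lambda>z. iterate_series a f z - (\<Sum>n<N. a (Suc n) * (f ^^ Suc n) z))
      \<le> C * sqrt (A - s N)" for N
  proof -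
    \<comment> \<open>The partial sum over \<open>n < N\<close> uses the coefficients with indices 1
      to \<open>N\<close>, hence \<open>n \<le> N\<close> here.\<close>
    define a' where "a' n = (if n \<le> N then 0 else a n)" for n
    have a'_Suc: "a' (Suc n) = (if n < N then 0 else a (Suc n))" for n
      by (auto simp: a'_def)
    have a': "(\<lambda>n. (norm (a' (Suc n)))\<^sup>2) sums (A - s N)"
      unfolding a'_Suc A_def s_def by (rule tail_square_sums[OF a])
    have "iterate_series a f z - (\<Sum>n<N. a (Suc n) * (f ^^ Suc n) z) = iterate_series a' f z"
      if z: "norm z < 1" for z
    proof -
      have sm: "summable (\<lambda>n. a (Suc n) * (f ^^ Suc n) z)"
        by (rule iterate_series_eq_martingale_series[OF a]) (use z in blast)
      have "(\<lambda>n. a (Suc n) * (f ^^ Suc n) z - (if n \<in> {..<N} then a (Suc n) * (f ^^ Suc n) z else 0))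
          sums (iterate_series a f z - (\<Sum>n<N. a (Suc n) * (f ^^ Suc n) z))"
        unfolding iterate_series_def
        by (intro sums_diff sums_If_finite_set summable_sums sm) auto
      moreover have "(\<lambda>n. a (Suc n) * (f ^^ Suc n) z - (if n \<in> {..<N} then a (Suc n) * (f ^^ Suc n) z else 0))
          = (\<lambda>n. a' (Suc n) * (f ^^ Suc n) z)"
        by (auto simp: a'_Suc)
      ultimately show ?thesis
        unfolding iterate_series_def[of a'] by (simp only: sums_iff)
    qed
    then have "hardy_norm 2 (\<lambda>z. iterate_series a f z - (\<Sum>n<N. a (Suc n) * (f ^^ Suc n) z))
        = hardy_norm 2 (iterate_series a' f)"
      unfolding hardy_norm_def by (subst hardy_mean_sup_cong) auto
    also have "\<dots> \<le> C * sqrt (A - s N)"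
      using C(2)[OF sums_summable[OF a']] sums_unique[OF a'] by simp
    finally show ?thesis .
  qed
  have "s \<longlonglongrightarrow> A"
    using summable_LIMSEQ[OF a] unfolding s_def[abs_def] A_def .
  then have "(\<lambda>N. C * sqrt (A - s N)) \<longlonglongrightarrow> C * sqrt (A - A)"
    by (intro tendsto_intros)
  then have lim: "(\<lambda>N. C * sqrt (A - s N)) \<longlonglongrightarrow> 0" by simp
  have "(\<lambda>N. hardy_norm 2 (\<lambda>z. iterate_series a f z - (\<Sum>n<N. a (Suc n) * (f ^^ Suc n) z))) \<longlonglongrightarrow> 0"
    by (rule tendsto_sandwich[OF always_eventually always_eventually tendsto_const lim])
       (use le in \<open>simp_all add: hardy_norm_def\<close>)
  then show ?thesis
    unfolding hardy_sums_def using summand conjunct1[OF C(2)[OF a]] by (intro conjI allI)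
qed

end

section \<open>From radial limits to square means, and the final assembly\<close>

text \<open>Radial limits of modulus one are used only here: dominated convergence with majorant 1,
  along sequences of radii because that theorem is sequential.\<close>

lemma inner_function_square_mean:
  assumes f: "inner_function f"
  shows "(circle_mean (\<lambda>z. (norm (f z))\<^sup>2) \<longlongrightarrow> 1) (at_left 1)"
proof (rule tendsto_at_left_sequentially[of 0])
  have cont: "continuous_on (ball 0 1) f" and lt: "norm (f z) < 1" if "norm z < 1" for z
    using f that by (auto simp: inner_function_def image_subset_iff intro: holomorphic_on_imp_continuous_on)
  fix S :: "nat \<Rightarrow> real"
  assume S: "\<And>n. S n < 1" "\<And>n. 0 < S n" "S \<longlonglongrightarrow> 1"
  have S_left: "filterlim S (at_left 1) sequentially"
    using S(1,3) by (auto simp: filterlim_at less_imp_neq intro!: always_eventually)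
  have "(\<lambda>n. circle_mean (\<lambda>z. (norm (f z))\<^sup>2) (S n)) \<longlonglongrightarrow> (\<integral>\<xi>. 1 \<partial>circle_measure)"
    unfolding circle_mean_def
  proof (rule integral_dominated_convergence[where w="\<lambda>_. 1"])
    have "AE \<xi> in circle_measure.
        \<exists>l. ((\<lambda>r. f (complex_of_real r * \<xi>)) \<longlongrightarrow> l) (at_left 1) \<and> norm l = 1"
      using f by (simp add: inner_function_def)
    then show "AE \<xi> in circle_measure. (\<lambda>n. (norm (f (of_real (S n) * \<xi>)))\<^sup>2) \<longlonglongrightarrow> 1"
    proof eventually_elim
      case (elim \<xi>)
      then obtain l where l: "((\<lambda>r. f (complex_of_real r * \<xi>)) \<longlongrightarrow> l) (at_left 1)" "norm l = 1"
        by blast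
      have "(\<lambda>n. (norm (f (of_real (S n) * \<xi>)))\<^sup>2) \<longlonglongrightarrow> (norm l)\<^sup>2"
        by (intro tendsto_intros filterlim_compose[OF l(1) S_left])
      with l(2) show ?case by simp
    qed
    show "AE \<xi> in circle_measure. norm ((norm (f (of_real (S n) * \<xi>)))\<^sup>2) \<le> 1" for n
    proof (rule AE_I2)
      fix \<xi> assume "\<xi> \<in> space circle_measure"
      then have "norm (f (of_real (S n) * \<xi>)) < 1"
        using S(1)[of n] S(2)[of n] by (intro lt) (simp add: norm_mult)
      then show "norm ((norm (f (of_real (S n) * \<xi>)))\<^sup>2) \<le> 1"
        by (simp add: power_le_one)
    qed
    show "(\<lambda>\<xi>. (norm (f (of_real (S n) * \<xi>)))\<^sup>2) \<in> borel_measurable circle_measure" for n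
      by (rule borel_measurable_circle)
         (use S(1)[of n] S(2)[of n] cont[of 0] in \<open>auto intro!: continuous_intros continuous_on_radial\<close>)
  qed auto
  then show "(\<lambda>n. circle_mean (\<lambda>z. (norm (f z))\<^sup>2) (S n)) \<longlonglongrightarrow> 1"
    by simp
qed simp

theorem corollary1p4:
  fixes f :: "complex \<Rightarrow> complex"
  assumes "inner_function f" and "f 0 = 0" and "\<not> is_rotation f"
  shows "(\<forall>a :: nat \<Rightarrow> complex. summable (\<lambda>n. (norm (a (Suc n)))\<^sup>2) \<longrightarrow>
            hardy_sums 2 (\<lambda>n z. a (Suc n) * (f ^^ Suc n) z) (iterate_series a f) \<and>
            (\<forall>p>0. iterate_series a f \<in> hardy_space p)) \<and>
         (\<forall>p>0. \<exists>C>0. \<forall>a :: nat \<Rightarrow> complex. summable (\<lambda>n. (norm (a (Suc n)))\<^sup>2) \<longrightarrow>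
            inverse C * sqrt (\<Sum>n. (norm (a (Suc n)))\<^sup>2) \<le> hardy_norm p (iterate_series a f) \<and>
            hardy_norm p (iterate_series a f) \<le> C * sqrt (\<Sum>n. (norm (a (Suc n)))\<^sup>2))"
proof -
  interpret inner_nonrotation f
  proof
    show "f holomorphic_on ball 0 1"
      using assms(1) by (simp add: inner_function_def)
    show "norm (f z) < 1" if "norm z < 1" for z
      using assms(1) that by (auto simp: inner_function_def image_subset_iff)
    show "(circle_mean (\<lambda>z. (norm (f z))\<^sup>2) \<longlongrightarrow> 1) (at_left 1)"
      by (rule inner_function_square_mean[OF assms(1)])
  qed (fact assms(2,3))+
  have "\<exists>C>0. \<forall>a :: nat \<Rightarrow> complex. summable (\<lambda>n. (norm (a (Suc n)))\<^sup>2) \<longrightarrow>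
            inverse C * sqrt (\<Sum>n. (norm (a (Suc n)))\<^sup>2) \<le> hardy_norm p (iterate_series a f) \<and>
            hardy_norm p (iterate_series a f) \<le> C * sqrt (\<Sum>n. (norm (a (Suc n)))\<^sup>2)"
    if p: "0 < p" for p
  proof -
    obtain C where C: "0 < C" "\<And>a. summable (\<lambda>n. (norm (a (Suc n)))\<^sup>2) \<Longrightarrow>
        hardy_norm p (iterate_series a f) \<le> C * sqrt (\<Sum>n. (norm (a (Suc n)))\<^sup>2)"
      by (rule hardy_norm_iterate_series_le[OF p]) blast
    obtain c where c: "0 < c" "\<And>a. summable (\<lambda>n. (norm (a (Suc n)))\<^sup>2) \<Longrightarrow>
        c * sqrt (\<Sum>n. (norm (a (Suc n)))\<^sup>2) \<le> hardy_norm p (iterate_series a f)"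
      by (rule hardy_norm_iterate_series_ge[OF p]) blast
    \<comment> \<open>The theorem wants one constant for both inequalities, with its inverse on the
      left.\<close>
    define K where "K = max C (inverse c)"
    have K: "0 < K" "C \<le> K" using C(1) by (auto simp: K_def)
    have "inverse K \<le> inverse (inverse c)"
      unfolding K_def using c(1) by (intro le_imp_inverse_le) auto
    then have Kc: "inverse K \<le> c" by simp
    show ?thesis
    proof (intro exI[of _ K] conjI allI impI K(1))
      fix a :: "nat \<Rightarrow> complex" assume a: "summable (\<lambda>n. (norm (a (Suc n)))\<^sup>2)"
      have nonneg: "0 \<le> sqrt (\<Sum>n. (norm (a (Suc n)))\<^sup>2)"
        by (intro real_sqrt_ge_zero suminf_nonneg a) simp
      show "inverse K * sqrt (\<Sum>n. (norm (a (Suc n)))\<^sup>2) \<le> hardy_norm p (iterate_series a f)"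
        using mult_right_mono[OF Kc nonneg] c(2)[OF a] by linarith
      show "hardy_norm p (iterate_series a f) \<le> K * sqrt (\<Sum>n. (norm (a (Suc n)))\<^sup>2)"
        using mult_right_mono[OF K(2) nonneg] C(2)[OF a] by linarith
    qed
  qed
  moreover have "iterate_series a f \<in> hardy_space p"
    if "summable (\<lambda>n. (norm (a (Suc n)))\<^sup>2)" "0 < p" for a p
    by (rule hardy_norm_iterate_series_le[OF that(2)]) (use that(1) in blast)
  ultimately show ?thesis
    using hardy_sums_iterate_series by (intro conjI allI impI)
qed

end
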